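(* Let $\Omega$ be a bounded domain in $\mathbb{C}^n$, $n\ge1$. Then for all $z\in\Omega$, $$v(I^A(z))\ \ge\ \frac{\pi^n}{n!}\,\delta^{2n}(z)\qquad\text{(A)}$$ and $$K(z)\ \le\ \frac{n!}{\pi^n\,\delta^{2n}(z)}.\qquad\text{(B)}$$ Moreover, for each of the two inequalities (A) and (B) and for $z_0\in\Omega$, equality holds at $z_0$ if and only if $\Omega$ is a ball centered at $z_0$.
   Context: $v(\cdot)$ is Euclidean volume (Lebesgue measure) in $\mathbb{C}^n$; $\delta(z)$ is the Euclidean distance from $z$ to $\partial\Omega$. The Bergman kernel on the diagonal is $K(z)=\sup\{|f(z)|^2: f\in L^2(\Omega)\cap\mathcal{O}(\Omega),\ \|f\|_{L^2(\Omega)}\le1\}$. The pluricomplex Green's function of $\Omega$ with pole $z$ is $$G_z(w)=\sup\{u(w): u\in PSH^-(\Omega),\ \limsup_{\zeta\to z}(u(\zeta)-\log|\zeta-z|)<\infty\},$$ where $PSH^-(\Omega)$ is the set of negative plurisubharmonic functions on $\Omega$. The Azukawa indicatrix at $z\in\Omega$ is $$I^A(z)=I^A_\Omega(z)=\{X\in\mathbb{C}^n:\limsup_{\zeta\to0}\,(G_z(z+\zeta X)-\log|\zeta|)<0\},\quad \zeta\in\mathbb{C}\setminus\{0\}.$$ No pseudoconvexity is assumed. *)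

theory Defs
  imports "HOL-Analysis.Analysis"
begin

definition domain_Cn :: "(complex^'n) set \<Rightarrow> bool" where
  "domain_Cn \<Omega> \<longleftrightarrow> open \<Omega> \<and> connected \<Omega> \<and> \<Omega> \<noteq> {}"

text \<open>The mean over the unit circle of an extended-real function \<open>g\<close>, as the integral of the
  positive part minus the integral of the negative part. It is used only for \<open>g\<close> upper
  semicontinuous and \<open>< \<infinity>\<close> on the circle; then the first integral is finite, and the mean is
  \<open>-\<infinity>\<close> exactly when the second one is infinite.\<close>

definition circle_mean :: "(complex \<Rightarrow> ereal) \<Rightarrow> ereal" where
  "circle_mean g =
     (enn2ereal (\<integral>\<^sup>+t\<in>{0..2*pi}. e2ennreal (g (cis t)) \<partial>lborel)
      - enn2ereal (\<integral>\<^sup>+t\<in>{0..2*pi}. e2ennreal (- g (cis t)) \<partial>lborel)) / ereal (2 * pi)"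

text \<open>Plurisubharmonicity on an open set: values in \<open>[-\<infinity>, \<infinity>)\<close>, upper semicontinuity, and the
  sub-mean value inequality on all closed discs in complex lines. The constant \<open>-\<infinity>\<close> is
  admitted; on a bounded domain this does not affect the supremum defining the Green
  function.\<close>

definition psh_on :: "(complex^'n \<Rightarrow> ereal) \<Rightarrow> (complex^'n) set \<Rightarrow> bool" where
  "psh_on u \<Omega> \<longleftrightarrow>
     (\<forall>w\<in>\<Omega>. u w < \<infinity>) \<and>
     (\<forall>c. openin (top_of_set \<Omega>) {w\<in>\<Omega>. u w < c}) \<and>
     (\<forall>a b. (\<forall>\<zeta>. norm \<zeta> \<le> 1 \<longrightarrow> a + \<zeta> *s b \<in> \<Omega>) \<longrightarrow>
        u a \<le> circle_mean (\<lambda>\<zeta>. u (a + \<zeta> *s b)))"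

definition PSH_neg :: "(complex^'n) set \<Rightarrow> (complex^'n \<Rightarrow> ereal) set" where
  "PSH_neg \<Omega> = {u. psh_on u \<Omega> \<and> (\<forall>w\<in>\<Omega>. u w < 0)}"

definition green :: "(complex^'n) set \<Rightarrow> complex^'n \<Rightarrow> complex^'n \<Rightarrow> ereal" where
  "green \<Omega> z w =
     (SUP u \<in> {u \<in> PSH_neg \<Omega>.
                Limsup (at z within \<Omega>) (\<lambda>\<zeta>. u \<zeta> - ereal (ln (norm (\<zeta> - z)))) < \<infinity>}. u w)"

text \<open>For \<open>z\<close> in the open set \<open>\<Omega>\<close> the limit superior only involves points \<open>z + \<zeta> *s X\<close> of \<open>\<Omega>\<close>;
  the values of \<open>green \<Omega> z\<close> outside \<open>\<Omega>\<close> are meaningless.\<close>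

definition azukawa_indicatrix :: "(complex^'n) set \<Rightarrow> complex^'n \<Rightarrow> (complex^'n) set" where
  "azukawa_indicatrix \<Omega> z =
     {X. Limsup (at 0) (\<lambda>\<zeta>::complex. green \<Omega> z (z + \<zeta> *s X) - ereal (ln (norm \<zeta>))) < 0}"

definition holomorphic_Cn_on :: "(complex^'n \<Rightarrow> complex) \<Rightarrow> (complex^'n) set \<Rightarrow> bool" where
  "holomorphic_Cn_on f \<Omega> \<longleftrightarrow>
     (\<forall>w\<in>\<Omega>. \<exists>D. (f has_derivative D) (at w) \<and> (\<forall>c v. D (c *s v) = c * D v))"

definition bergman_space :: "(complex^'n) set \<Rightarrow> (complex^'n \<Rightarrow> complex) set" where
  "bergman_space \<Omega> =
     {f. holomorphic_Cn_on f \<Omega> \<and> set_integrable lebesgue \<Omega> (\<lambda>w. (norm (f w))\<^sup>2)}"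

definition L2_norm_on :: "(complex^'n) set \<Rightarrow> (complex^'n \<Rightarrow> complex) \<Rightarrow> real" where
  "L2_norm_on \<Omega> f = sqrt (LINT w:\<Omega>|lebesgue. (norm (f w))\<^sup>2)"

definition bergman_kernel :: "(complex^'n) set \<Rightarrow> complex^'n \<Rightarrow> ennreal" where
  "bergman_kernel \<Omega> z =
     (SUP f \<in> {f \<in> bergman_space \<Omega>. L2_norm_on \<Omega> f \<le> 1}. ennreal ((norm (f z))\<^sup>2))"

definition bdry_dist :: "(complex^'n) set \<Rightarrow> complex^'n \<Rightarrow> real" where
  "bdry_dist \<Omega> z = infdist z (frontier \<Omega>)"

end

theory Submission
  imports Defs "HOL-Complex_Analysis.Complex_Analysis"
begin

text \<open>On a complex line through \<open>z\<close>, a competitor \<open>u\<close> in the Green function is dominated, by the maximum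
  principle on the punctured disc, by \<open>ln (\<bar>\<zeta>\<bar> / r)\<close> plus any harmonic function that dominates it on the
  circle of radius \<open>r\<close>. With the zero function this puts the ball of radius \<open>\<delta>(z)\<close> into the indicatrix.
  If \<open>\<Omega>\<close> is not that ball, it contains a point \<open>p\<close> of the bounding sphere; for directions near \<open>p - z\<close>
  the slices contain the unit disc and a neighbourhood of \<open>1\<close>, where \<open>u\<close> is bounded away from \<open>0\<close>, and a
  multiple of a Poisson kernel gives a uniform gain, so that the indicatrix contains an open set outside the ball.

  For the Bergman kernel, the mean over the ball of radius \<open>\<delta>(z)\<close> reproduces the value at \<open>z\<close>, and the
  Cauchy--Schwarz inequality gives the bound. If \<open>\<Omega>\<close> is not the ball, this functional can be shortened
  by adding a multiple of a difference of two concentric ball means near \<open>p\<close>, which annihilates the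
  Bergman space.\<close>

section \<open>The maximum principle on the punctured disc\<close>

text \<open>Plurisubharmonic functions enter through their negatives, which are nonnegative and
  lower semicontinuous: this yields minima on compact sets, Fatou's lemma, and circle means that are
  integrals of nonnegative functions. The obstacle in (A) is measurability: \<open>emeasure\<close>
  is 0 on a nonmeasurable set, so the indicatrix has to be shown to be Borel. The upper
  semicontinuity of the Green function, derived from the supremum itself, serves only this purpose.
  Each slice estimate is proved for a single competitor with constants that do not depend on it,
  hence passes to the supremum. At \<open>p\<close> the gain must in addition be uniform in the
  direction: for n > 1, an estimate on the single line through \<open>p\<close> would add only a
  null set. On the ball, the competitor is the logarithm of a linear form rather than of the norm,
  because on a complex line it becomes ln |a + b \<zeta>|, whose circle means are explicit; one
  competitor per direction suffices, since the indicatrix is tested one line at a time.\<close>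

definition lsc_on :: "'a::topological_space set \<Rightarrow> ('a \<Rightarrow> 'b::linorder) \<Rightarrow> bool" where
  "lsc_on K f \<longleftrightarrow> (\<forall>x\<in>K. \<forall>c<f x. \<forall>\<^sub>F y in at x within K. c < f y)"

text \<open>If no minimum is attained, each \<open>x\<close> in \<open>K\<close> has a point
  \<open>g x\<close> of smaller value, and \<open>f\<close> stays above \<open>f (g x)\<close> near
  \<open>x\<close>. In a finite subcover choose the least of the values \<open>f (g x)\<close>; its
  point \<open>g x0\<close> lies in some \<open>U x\<close>, so \<open>f (g x)\<close> is smaller
  still.\<close>

lemma lsc_on_attains_inf:
  assumes "compact K" "K \<noteq> {}" "lsc_on K f"
  obtains x where "x \<in> K" "\<And>y. y \<in> K \<Longrightarrow> f x \<le> f y"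
proof (rule ccontr)
  assume "\<not> thesis"
  with that have "\<forall>x\<in>K. \<exists>y\<in>K. f y < f x"
    by (meson not_le)
  then obtain g where g: "\<And>x. x \<in> K \<Longrightarrow> g x \<in> K \<and> f (g x) < f x" by metis
  have "\<exists>U. open U \<and> x \<in> U \<and> (\<forall>y\<in>U\<inter>K. f (g x) < f y)" if "x \<in> K" for x
  proof -
    have "\<forall>\<^sub>F y in at x within K. f (g x) < f y"
      using assms(3) g[OF that] that by (auto simp: lsc_on_def)
    then obtain U where "open U" "x \<in> U" "\<forall>y\<in>U. y \<noteq> x \<longrightarrow> y \<in> K \<longrightarrow> f (g x) < f y"
      by (auto simp: eventually_at_topological)
    then show ?thesis using g[OF that] by (intro exI[of _ U]) auto
  qed
  then obtain U where U: "\<And>x. x \<in> K \<Longrightarrow> open (U x) \<and> x \<in> U x \<and> (\<forall>y\<in>U x \<inter> K. f (g x) < f y)" by metis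
  obtain D where D: "D \<subseteq> K" "finite D" "K \<subseteq> (\<Union>x\<in>D. U x)"
    using compactE_image[OF assms(1), of K U] U by blast
  have "D \<noteq> {}" using D assms(2) by auto
  then obtain x0 where x0: "x0 \<in> D" "\<And>x. x \<in> D \<Longrightarrow> f (g x0) \<le> f (g x)"
    using ex_min_if_finite[of "(\<lambda>x. f (g x)) ` D"] D(2) by (fastforce simp: not_less)
  have "g x0 \<in> K" using g x0 D by auto
  then obtain x where "x \<in> D" "g x0 \<in> U x" using D by auto
  then have "f (g x) < f (g x0)" using U D \<open>g x0 \<in> K\<close> by auto
  with x0 \<open>x \<in> D\<close> show False by fastforce
qed

lemma lsc_on_add_real:
  fixes s :: "'a::topological_space \<Rightarrow> ereal"
  assumes s: "lsc_on K s" "\<And>x. x \<in> K \<Longrightarrow> s x \<noteq> - \<infinity>" and L: "continuous_on K L"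
  shows "lsc_on K (\<lambda>x. s x + ereal (L x))"
  unfolding lsc_on_def
proof (intro ballI allI impI)
  fix x c assume x: "x \<in> K" and c: "c < s x + ereal (L x)"
  have "c - ereal (L x) < s x"
    using c by (cases c; cases "s x") auto
  then obtain d where d: "c - ereal (L x) < ereal d" "ereal d < s x"
    using ereal_dense2 by blast
  have 1: "\<forall>\<^sub>F y in at x within K. ereal d < s y"
    using s(1) x d(2) by (auto simp: lsc_on_def)
  have "(L \<longlongrightarrow> L x) (at x within K)" using L x by (auto simp: continuous_on_def)
  then have "((\<lambda>y. ereal (d + L y)) \<longlongrightarrow> ereal (d + L x)) (at x within K)"
    by (intro tendsto_intros)
  moreover have "c < ereal (d + L x)" using d by (cases c) auto
  ultimately have 2: "\<forall>\<^sub>F y in at x within K. c < ereal (d + L y)"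
    by (rule order_tendstoD)
  show "\<forall>\<^sub>F y in at x within K. c < s y + ereal (L y)"
    using 1 2
  proof eventually_elim
    case (elim y)
    then show ?case by (cases "s y"; cases c) auto
  qed
qed

lemma lsc_on_subset: "lsc_on K f \<Longrightarrow> L \<subseteq> K \<Longrightarrow> lsc_on L f"
  unfolding lsc_on_def using at_le filter_leD by blast

section \<open>Circle means of holomorphic functions, of ln |a + b \<zeta>| and of the squared
  modulus\<close>

lemma has_integral_circle_mean_value:
  assumes "continuous_on (cball a r) f" "f holomorphic_on ball a r" "0 < r"
  shows "((\<lambda>t. f (a + of_real r * cis t)) has_integral of_real (2 * pi) * f a) {0..2*pi}"
proof -
  have "((\<lambda>u. f u/(u-a)) has_contour_integral (2 * of_real pi * \<i> * f a)) (circlepath a r)"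
    using assms by (intro Cauchy_integral_circlepath) auto
  then have "((\<lambda>t. f (a + r * cis t) / (a + r * cis t - a) * r * \<i> * cis t) has_integral
      2 * of_real pi * \<i> * f a) {0..2*pi}"
    unfolding circlepath_def by (subst (asm) has_contour_integral_part_circlepath_iff) auto
  then have "((\<lambda>t. f (a + r * cis t) * \<i>) has_integral 2 * of_real pi * \<i> * f a) {0..2*pi}"
    by (rule has_integral_eq[rotated]) (use assms in \<open>auto simp: field_simps\<close>)
  from has_integral_mult_left[OF this, of "-\<i>"] show ?thesis
    by (simp add: algebra_simps)
qed

lemma has_integral_circle_mean_value_Re:
  assumes "continuous_on (cball a r) f" "f holomorphic_on ball a r" "0 < r"
  shows "((\<lambda>t. Re (f (a + of_real r * cis t))) has_integral 2 * pi * Re (f a)) {0..2*pi}"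
proof -
  have "Re (of_real (2 * pi) * f a) = 2 * pi * Re (f a)" by (simp del: of_real_mult)
  then show ?thesis
    using has_integral_linear[OF has_integral_circle_mean_value[OF assms] bounded_linear_Re]
    unfolding o_def by (simp only:)
qed

lemma nn_integral_Icc_ge:
  fixes g :: "real \<Rightarrow> real"
  assumes "continuous_on {a..b} g" "(g has_integral I) {a..b}"
    and "\<And>t. t \<in> {a..b} \<Longrightarrow> ennreal (g t) \<le> s t"
  shows "ennreal I \<le> (\<integral>\<^sup>+t\<in>{a..b}. s t \<partial>lborel)"
proof -
  \<comment> \<open>\<open>ennreal\<close> truncates the negative values of \<open>g\<close>;
    passing to the positive part can only increase the integral.\<close>
  let ?h = "\<lambda>t. max 0 (g t)"
  have c: "continuous_on {a..b} ?h" by (intro continuous_intros assms)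
  then have "?h integrable_on {a..b}" by (rule integrable_continuous_real)
  then have J: "(?h has_integral integral {a..b} ?h) {a..b}" by (rule integrable_integral)
  have "I \<le> integral {a..b} ?h" using has_integral_le[OF assms(2) J] by auto
  have "integral\<^sup>N lborel (\<lambda>x. indicator {a..b} x * ?h x) = integral {a..b} ?h"
    using J by (intro nn_integral_has_integral_lebesgue) auto
  then have "ennreal (integral {a..b} ?h) = integral\<^sup>N lborel (\<lambda>x. indicator {a..b} x * ?h x)" by simp
  also have "\<dots> \<le> (\<integral>\<^sup>+t\<in>{a..b}. s t \<partial>lborel)"
    using assms(3) by (intro nn_integral_mono) (auto simp: indicator_def max_def ennreal_neg split: if_splits)
  finally show ?thesis using \<open>I \<le> _\<close> by (meson ennreal_leI order_trans)
qed

lemma nn_integral_Icc_eq: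
  fixes g :: "real \<Rightarrow> real"
  assumes "(g has_integral I) {a..b}" "\<And>t. 0 \<le> g t"
  shows "(\<integral>\<^sup>+t\<in>{a..b}. ennreal (g t) \<partial>lborel) = ennreal I"
proof -
  have "integral\<^sup>N lborel (\<lambda>x. indicator {a..b} x * g x) = ennreal I"
    using assms by (intro nn_integral_has_integral_lebesgue) auto
  moreover have "(\<lambda>x. ennreal (indicator {a..b} x * g x)) = (\<lambda>x. ennreal (g x) * indicator {a..b} x)"
    by (auto simp: indicator_def)
  ultimately show ?thesis by simp
qed

text \<open>Dividing by \<open>a\<close> brings the image of the closed unit disc within distance
  less than 1 of the point 1, hence into the right half plane, where \<open>Ln\<close> is
  holomorphic. The mean value property of its real part gives the claim.\<close>

lemma has_integral_circle_ln_norm: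
  assumes "norm b < norm a"
  shows "((\<lambda>t. ln (norm (a + b * cis t))) has_integral 2 * pi * ln (norm a)) {0..2*pi}"
proof -
  have a: "a \<noteq> 0" using assms by auto
  have nz: "(a + b * \<zeta>) / a \<notin> \<real>\<^sub>\<le>\<^sub>0 \<and> a + b * \<zeta> \<noteq> 0" if "\<zeta> \<in> cball 0 1" for \<zeta>
  proof -
    have "norm (1 - (a + b * \<zeta>) / a) = norm b * norm \<zeta> / norm a"
      using a by (simp add: field_simps flip: norm_divide norm_mult)
    also have "\<dots> \<le> norm b / norm a" using that by (intro divide_right_mono mult_left_le) auto
    also have "\<dots> < 1" using assms a by simp
    finally have "norm (1 - (a + b * \<zeta>) / a) < 1" .
    then have "\<bar>Re (1 - (a + b * \<zeta>) / a)\<bar> < 1" using abs_Re_le_cmod order_le_less_trans by blast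
    then have "Re ((a + b * \<zeta>) / a) > 0" unfolding minus_complex.simps one_complex.simps by linarith
    then show ?thesis by (auto simp: complex_nonpos_Reals_iff)
  qed
  have hol: "(\<lambda>\<zeta>. Ln ((a + b * \<zeta>) / a)) holomorphic_on cball 0 1"
    using nz a by (auto intro!: holomorphic_intros)
  have "((\<lambda>t. Re (Ln ((a + b * (0 + of_real 1 * cis t)) / a))) has_integral 2 * pi * Re (Ln ((a + b * 0) / a))) {0..2*pi}"
    using hol
    by (intro has_integral_circle_mean_value_Re[where f="\<lambda>\<zeta>. Ln ((a + b * \<zeta>) / a)"])
       (auto intro: holomorphic_on_imp_continuous_on holomorphic_on_subset)
  moreover have "Re (Ln ((a + b * (0 + of_real 1 * cis t)) / a)) = ln (norm (a + b * cis t)) - ln (norm a)" for t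
    using a nz[of "cis t"] by (simp add: norm_divide ln_div)
  ultimately have "((\<lambda>t. ln (norm (a + b * cis t)) - ln (norm a)) has_integral 0) {0..2*pi}"
    using a by simp
  from has_integral_add[OF this has_integral_const_real[of "ln (norm a)" 0 "2*pi"]]
  show ?thesis by simp
qed

text \<open>The surplus \<open>\<rho>\<^sup>2\<close> over the value at the centre is what
  contradicts an interior minimum in the comparison below.\<close>

lemma has_integral_circle_norm_square:
  fixes a :: complex
  assumes "0 < \<rho>"
  shows "((\<lambda>t. (norm (a + of_real \<rho> * cis t))\<^sup>2) has_integral 2 * pi * ((norm a)\<^sup>2 + \<rho>\<^sup>2)) {0..2*pi}"
proof -
  have "((\<lambda>t. Re (cnj a * ((a + of_real \<rho> * cis t) - a))) has_integral 2 * pi * Re (cnj a * (a - a))) {0..2*pi}"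
    using assms
    by (intro has_integral_circle_mean_value_Re[where f="\<lambda>\<zeta>. cnj a * (\<zeta> - a)"])
       (auto intro!: holomorphic_intros continuous_intros)
  from has_integral_mult_right[OF this, of 2]
  have "((\<lambda>t. 2 * Re (cnj a * (of_real \<rho> * cis t))) has_integral 0) {0..2*pi}" by simp
  from has_integral_add[OF this has_integral_const_real[of "(norm a)\<^sup>2 + \<rho>\<^sup>2" 0 "2*pi"]]
  have "((\<lambda>t. 2 * Re (cnj a * (of_real \<rho> * cis t)) + ((norm a)\<^sup>2 + \<rho>\<^sup>2)) has_integral 2 * pi * ((norm a)\<^sup>2 + \<rho>\<^sup>2)) {0..2*pi}"
    by (simp add: algebra_simps)
  moreover have "2 * Re (cnj a * (of_real \<rho> * cis t)) + ((norm a)\<^sup>2 + \<rho>\<^sup>2) = (norm (a + of_real \<rho> * cis t))\<^sup>2" for t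
  proof -
    have "\<rho> * \<rho> = \<rho> * (\<rho> * (cos t * cos t)) + \<rho> * (\<rho> * (sin t * sin t))"
      by (metis distrib_left mult.right_neutral sin_cos_squared_add3)
    then show ?thesis unfolding cmod_power2
      by (simp add: power2_eq_square algebra_simps)
  qed
  ultimately show ?thesis by simp
qed

text \<open>Minimise \<open>s + L\<close> over an annulus around the pole. The factor
  \<open>1 - e\<close> weakens the logarithm, so that the pole of \<open>s\<close> wins on a small
  circle whatever the constant \<open>C\<close> is; the term
  \<open>- e * (norm \<zeta>)\<^sup>2\<close> makes \<open>L\<close> strictly superharmonic, which
  excludes an interior minimum of finite value; on the outer circle the boundary hypothesis
  applies.\<close>

lemma superharmonic_pole_minorant_perturbed:
  fixes s :: "complex \<Rightarrow> ereal"
  assumes r: "0 < r" and lsc: "lsc_on (cball 0 r - {0}) s"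
    and nonneg: "\<And>\<zeta>. \<zeta> \<in> cball 0 r - {0} \<Longrightarrow> 0 \<le> s \<zeta>"
    and super: "\<And>a \<rho>. 0 < \<rho> \<Longrightarrow> cball a \<rho> \<subseteq> ball 0 r - {0} \<Longrightarrow>
      (\<integral>\<^sup>+t\<in>{0..2*pi}. e2ennreal (s (a + of_real \<rho> * cis t)) \<partial>lborel) \<le> e2ennreal (ereal (2 * pi) * s a)"
    and pole: "\<forall>\<^sub>F \<zeta> in at 0. ereal (- ln (norm \<zeta>) - C) \<le> s \<zeta>"
    and F: "continuous_on (cball 0 r) F" "F holomorphic_on ball 0 r"
    and bd: "\<And>\<zeta>. norm \<zeta> = r \<Longrightarrow> ereal (- Re (F \<zeta>)) \<le> s \<zeta>"
    and \<zeta>: "0 < norm \<zeta>" "norm \<zeta> \<le> r" and e: "0 < e" "e < 1"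
  shows "ereal (- e * r\<^sup>2) \<le> s \<zeta> + ereal ((1 - e) * ln (norm \<zeta> / r) + Re (F \<zeta>) - e * (norm \<zeta>)\<^sup>2)"
proof -
  define L where "L \<zeta> = (1 - e) * ln (norm \<zeta> / r) + Re (F \<zeta>) - e * (norm \<zeta>)\<^sup>2" for \<zeta>
  have cL: "continuous_on (cball 0 r - {0}) L"
    unfolding L_def using r
    by (intro continuous_intros continuous_on_subset[OF F(1)]) auto
  obtain d0 where d0: "0 < d0" "\<And>\<zeta>. 0 < norm \<zeta> \<Longrightarrow> norm \<zeta> < d0 \<Longrightarrow> ereal (- ln (norm \<zeta>) - C) \<le> s \<zeta>"
    using pole by (auto simp: eventually_at)
  have "bounded (F ` cball 0 r)" using F(1) by (intro compact_imp_bounded compact_continuous_image) auto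
  then obtain B where B: "\<And>\<zeta>. norm \<zeta> \<le> r \<Longrightarrow> norm (F \<zeta>) \<le> B"
    unfolding bounded_iff by (metis dist_0_norm image_eqI mem_cball)
  \<comment> \<open>At radius \<open>E\<close> the surplus \<open>- e * ln (norm x)\<close> left by
    the weakened pole equals the sum of all constants: \<open>C\<close>, the term in
    \<open>ln r\<close>, and the bound \<open>B\<close> of \<open>F\<close>. The minimum with
    \<open>norm \<zeta>\<close> in \<open>\<epsilon>\<close> keeps the given point in the
    annulus.\<close>
  define E where "E = exp (- (C + (1 - e) * ln r + B) / e)"
  define \<epsilon> where "\<epsilon> = min (min (d0/2) E) (norm \<zeta>)"
  have eps: "0 < \<epsilon>" "\<epsilon> < d0" "\<epsilon> \<le> E" "\<epsilon> \<le> norm \<zeta>" using d0 \<zeta> by (auto simp: \<epsilon>_def E_def)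
  define K where "K = cball 0 r - ball (0::complex) \<epsilon>"
  have "compact K" unfolding K_def by (intro compact_diff) auto
  have "\<zeta> \<in> K" using \<zeta> eps by (auto simp: K_def)
  have Ksub: "K \<subseteq> cball 0 r - {0}" using eps by (auto simp: K_def)
  have "lsc_on K (\<lambda>\<zeta>. s \<zeta> + ereal (L \<zeta>))"
    using Ksub nonneg by (intro lsc_on_add_real lsc_on_subset[OF lsc] continuous_on_subset[OF cL]) fastforce+
  then obtain x where x: "x \<in> K" "\<And>y. y \<in> K \<Longrightarrow> s x + ereal (L x) \<le> s y + ereal (L y)"
    using lsc_on_attains_inf[OF \<open>compact K\<close>] \<open>\<zeta> \<in> K\<close> by blast
  have "ereal (- e * r\<^sup>2) \<le> s x + ereal (L x)"
  proof (rule ccontr)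
    assume "\<not> ?thesis"
    then have neg: "s x + ereal (L x) < ereal (- e * r\<^sup>2)" by simp
    have x0: "x \<noteq> 0" "norm x \<le> r" "\<epsilon> \<le> norm x" using x(1) Ksub unfolding K_def by fastforce+
    have "x \<in> cball 0 r - {0}" using x(1) Ksub by blast
    then have "0 \<le> s x" by (rule nonneg)
    then obtain \<sigma> where \<sigma>: "s x = ereal \<sigma>" "0 \<le> \<sigma>" using neg by (cases "s x") auto
    have neg': "\<sigma> + L x < - e * r\<^sup>2" using neg \<sigma> by simp
    have sq: "e * (norm x)\<^sup>2 \<le> e * r\<^sup>2" using e x0 by (intro mult_left_mono power_mono) auto
    have "norm x \<noteq> r"
    proof
      assume "norm x = r"
      then have "- Re (F x) \<le> \<sigma>" using bd[of x] \<sigma> by simp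
      with neg' \<open>norm x = r\<close> r show False by (simp add: L_def)
    qed
    moreover have "norm x \<noteq> \<epsilon>"
    proof
      assume nx: "norm x = \<epsilon>"
      then have 1: "- ln (norm x) - C \<le> \<sigma>" using d0(2)[of x] \<sigma> eps x0 by simp
      have "ln (norm x) \<le> ln E" using nx eps by simp
      also have "\<dots> = - (C + (1 - e) * ln r + B) / e" by (simp add: E_def)
      finally have "e * ln (norm x) \<le> - (C + (1 - e) * ln r + B)" using e by (simp add: field_simps)
      moreover have "- B \<le> Re (F x)" using B[of x] abs_Re_le_cmod[of "F x"] x0 by linarith
      moreover have "L x = ln (norm x) - e * ln (norm x) - (1 - e) * ln r + Re (F x) - e * (norm x)\<^sup>2"
        using r x0 by (simp add: L_def ln_div algebra_simps)
      ultimately show False using neg' 1 sq by linarith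
    qed
    ultimately have xs: "\<epsilon> < norm x" "norm x < r" using x0 by auto
    define \<rho> where "\<rho> = min (norm x - \<epsilon>) (r - norm x) / 2"
    have \<rho>: "0 < \<rho>" "\<rho> < norm x - \<epsilon>" "\<rho> < r - norm x" using xs by (auto simp: \<rho>_def)
    have sub: "y \<in> K \<and> y \<in> ball 0 r - {0}" if "y \<in> cball x \<rho>" for y
    proof -
      have "norm (x - y) \<le> \<rho>" using that by (simp add: dist_norm)
      then have "norm y < r" "\<epsilon> < norm y" using \<rho> norm_triangle_ineq2[of x y] norm_triangle_ineq2[of y x]
        by (auto simp: norm_minus_commute)
      then show ?thesis using eps by (auto simp: K_def)
    qed
    have circ: "x + of_real \<rho> * cis t \<in> cball x \<rho>" for t using \<rho> by (simp add: dist_norm norm_mult)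
    have "((\<lambda>t. Re (F (x + of_real \<rho> * cis t))) has_integral 2 * pi * Re (F x)) {0..2*pi}"
    proof (intro has_integral_circle_mean_value_Re continuous_on_subset[OF F(1)] holomorphic_on_subset[OF F(2)] \<rho>)
      show "cball x \<rho> \<subseteq> cball 0 r" using sub by (fastforce dest: less_imp_le)
      show "ball x \<rho> \<subseteq> ball 0 r" using sub ball_subset_cball[of x \<rho>] by blast
    qed
    moreover have "((\<lambda>t. ln (norm (x + of_real \<rho> * cis t))) has_integral 2 * pi * ln (norm x)) {0..2*pi}"
      using \<rho> eps by (intro has_integral_circle_ln_norm) auto
    moreover have "((\<lambda>t. (norm (x + of_real \<rho> * cis t))\<^sup>2) has_integral 2 * pi * ((norm x)\<^sup>2 + \<rho>\<^sup>2)) {0..2*pi}"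
      using \<rho> by (intro has_integral_circle_norm_square)
    moreover have "((\<lambda>t. \<sigma> + L x + (1 - e) * ln r) has_integral 2 * pi * (\<sigma> + L x + (1 - e) * ln r)) {0..2*pi}"
      using has_integral_const_real[of "\<sigma> + L x + (1 - e) * ln r" 0 "2*pi"] by simp
    ultimately have "((\<lambda>t. (\<sigma> + L x + (1 - e) * ln r) - (1 - e) * ln (norm (x + of_real \<rho> * cis t))
        - Re (F (x + of_real \<rho> * cis t)) + e * (norm (x + of_real \<rho> * cis t))\<^sup>2) has_integral
        (2 * pi * (\<sigma> + L x + (1 - e) * ln r) - (1 - e) * (2 * pi * ln (norm x)) - 2 * pi * Re (F x)
         + e * (2 * pi * ((norm x)\<^sup>2 + \<rho>\<^sup>2)))) {0..2*pi}"
      by (intro has_integral_add has_integral_diff has_integral_mult_right)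
    moreover have "(\<lambda>t. (\<sigma> + L x + (1 - e) * ln r) - (1 - e) * ln (norm (x + of_real \<rho> * cis t))
        - Re (F (x + of_real \<rho> * cis t)) + e * (norm (x + of_real \<rho> * cis t))\<^sup>2) =
        (\<lambda>t. \<sigma> + L x - L (x + of_real \<rho> * cis t))"
    proof
      fix t
      have "norm (x + of_real \<rho> * cis t) > 0" using sub[OF circ[of t]] by simp
      then show "(\<sigma> + L x + (1 - e) * ln r) - (1 - e) * ln (norm (x + of_real \<rho> * cis t))
        - Re (F (x + of_real \<rho> * cis t)) + e * (norm (x + of_real \<rho> * cis t))\<^sup>2 = \<sigma> + L x - L (x + of_real \<rho> * cis t)"
        using r unfolding L_def by (subst (2) ln_div) (auto simp: algebra_simps)
    qed
    moreover have "2 * pi * (\<sigma> + L x + (1 - e) * ln r) - (1 - e) * (2 * pi * ln (norm x)) - 2 * pi * Re (F x)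
         + e * (2 * pi * ((norm x)\<^sup>2 + \<rho>\<^sup>2)) = 2 * pi * (\<sigma> + e * \<rho>\<^sup>2)"
      using r x0 by (simp add: L_def ln_div algebra_simps)
    ultimately have I: "((\<lambda>t. \<sigma> + L x - L (x + of_real \<rho> * cis t)) has_integral 2 * pi * (\<sigma> + e * \<rho>\<^sup>2)) {0..2*pi}"
      by simp
    \<comment> \<open>By minimality at \<open>x\<close>, \<open>s\<close> dominates
      \<open>\<sigma> + L x - L\<close> on the circle. The mean of this minorant is
      \<open>\<sigma> + e * \<rho>\<^sup>2\<close>, whereas the mean of \<open>s\<close> is at most
      \<open>\<sigma>\<close>.\<close>
    have "ennreal (2 * pi * (\<sigma> + e * \<rho>\<^sup>2)) \<le> (\<integral>\<^sup>+t\<in>{0..2*pi}. e2ennreal (s (x + of_real \<rho> * cis t)) \<partial>lborel)"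
    proof (rule nn_integral_Icc_ge[OF _ I])
      show "continuous_on {0..2*pi} (\<lambda>t. \<sigma> + L x - L (x + of_real \<rho> * cis t))"
      proof (intro continuous_intros continuous_on_compose2[OF cL])
        show "(\<lambda>t. x + of_real \<rho> * cis t) ` {0..2*pi} \<subseteq> cball 0 r - {0}"
          using subsetD[OF Ksub conjunct1[OF sub[OF circ]]] by (rule image_subsetI)
      qed
    next
      fix t assume "t \<in> {0..2*pi}"
      have "ereal (\<sigma> + L x) \<le> s (x + of_real \<rho> * cis t) + ereal (L (x + of_real \<rho> * cis t))"
        using x(2) sub[OF circ] \<sigma> by simp
      then have "ereal (\<sigma> + L x - L (x + of_real \<rho> * cis t)) \<le> s (x + of_real \<rho> * cis t)"
        by (cases "s (x + of_real \<rho> * cis t)") auto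
      from e2ennreal_mono[OF this]
      show "ennreal (\<sigma> + L x - L (x + of_real \<rho> * cis t)) \<le> e2ennreal (s (x + of_real \<rho> * cis t))"
        by simp
    qed
    also have "\<dots> \<le> e2ennreal (ereal (2 * pi) * s x)"
      using sub \<rho>(1) by (intro super subsetI) auto
    also have "\<dots> = ennreal (2 * pi * \<sigma>)" using \<sigma> by simp
    finally have "2 * pi * (\<sigma> + e * \<rho>\<^sup>2) \<le> 2 * pi * \<sigma>" using \<sigma> by (subst (asm) ennreal_le_iff) auto
    then have "e * \<rho>\<^sup>2 \<le> 0" by simp
    then show False using e \<rho> by (simp add: mult_le_0_iff)
  qed
  with x(2)[OF \<open>\<zeta> \<in> K\<close>] show ?thesis unfolding L_def by (rule order_trans[rotated])
qed

text \<open>Let \<open>e\<close> tend to 0. The function \<open>F\<close> carries boundary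
  information better than nonnegativity: \<open>F = 0\<close> gives the estimate behind the ball, a
  Poisson kernel gives the gain at a bulge.\<close>

lemma superharmonic_pole_minorant:
  fixes s :: "complex \<Rightarrow> ereal"
  assumes r: "0 < r" and lsc: "lsc_on (cball 0 r - {0}) s"
    and nonneg: "\<And>\<zeta>. \<zeta> \<in> cball 0 r - {0} \<Longrightarrow> 0 \<le> s \<zeta>"
    and super: "\<And>a \<rho>. 0 < \<rho> \<Longrightarrow> cball a \<rho> \<subseteq> ball 0 r - {0} \<Longrightarrow>
      (\<integral>\<^sup>+t\<in>{0..2*pi}. e2ennreal (s (a + of_real \<rho> * cis t)) \<partial>lborel) \<le> e2ennreal (ereal (2 * pi) * s a)"
    and pole: "\<forall>\<^sub>F \<zeta> in at 0. ereal (- ln (norm \<zeta>) - C) \<le> s \<zeta>"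
    and F: "continuous_on (cball 0 r) F" "F holomorphic_on ball 0 r"
    and bd: "\<And>\<zeta>. norm \<zeta> = r \<Longrightarrow> ereal (- Re (F \<zeta>)) \<le> s \<zeta>"
    and \<zeta>: "0 < norm \<zeta>" "norm \<zeta> \<le> r"
  shows "ereal (ln (r / norm \<zeta>) - Re (F \<zeta>)) \<le> s \<zeta>"
proof (cases "s \<zeta>")
  case (real \<sigma>)
  have *: "- e * r\<^sup>2 \<le> \<sigma> + ((1 - e) * ln (norm \<zeta> / r) + Re (F \<zeta>) - e * (norm \<zeta>)\<^sup>2)" if "0 < e" "e < 1" for e
    using superharmonic_pole_minorant_perturbed[OF assms that] real by simp
  have "- 0 * r\<^sup>2 \<le> \<sigma> + ((1 - 0) * ln (norm \<zeta> / r) + Re (F \<zeta>) - 0 * (norm \<zeta>)\<^sup>2)"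
  proof (rule tendsto_le)
    show "((\<lambda>e. - e * r\<^sup>2) \<longlongrightarrow> - 0 * r\<^sup>2) (at_right 0)" by (intro tendsto_intros)
    show "((\<lambda>e. \<sigma> + ((1 - e) * ln (norm \<zeta> / r) + Re (F \<zeta>) - e * (norm \<zeta>)\<^sup>2)) \<longlongrightarrow>
       \<sigma> + ((1 - 0) * ln (norm \<zeta> / r) + Re (F \<zeta>) - 0 * (norm \<zeta>)\<^sup>2)) (at_right 0)" by (intro tendsto_intros)
    show "\<forall>\<^sub>F e in at_right 0. - e * r\<^sup>2 \<le> \<sigma> + ((1 - e) * ln (norm \<zeta> / r) + Re (F \<zeta>) - e * (norm \<zeta>)\<^sup>2)"
      using * by (auto simp: eventually_at_right_field intro!: exI[of _ 1])
  qed simp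
  moreover have "r \<noteq> 0" using r by simp
  moreover have "ln (norm \<zeta> / r) = ln (norm \<zeta>) - ln r" "ln (r / norm \<zeta>) = ln r - ln (norm \<zeta>)"
    using \<open>r \<noteq> 0\<close> \<zeta>(1) by (simp_all add: ln_div)
  ultimately show ?thesis using real by simp
next
  case MInf
  then show ?thesis using nonneg[of \<zeta>] \<zeta> by auto
qed auto

section \<open>Slices of plurisubharmonic functions\<close>

lemma norm_vector_scalar_mult: "norm (c *s (x::complex^'n)) = norm c * norm x"
  by (simp add: norm_vec_def L2_set_right_distrib norm_mult)

lemma bounded_linear_scalar_mult_left: "bounded_linear (\<lambda>c. c *s (x::complex^'n))"
  by (rule bounded_linear_intro[where K="norm x"])
     (auto simp: vec_eq_iff algebra_simps norm_vector_scalar_mult)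

lemma bounded_linear_scalar_mult_right: "bounded_linear (\<lambda>x. c *s (x::complex^'n))"
  by (rule bounded_linear_intro[where K="norm c"])
     (auto simp: vec_eq_iff algebra_simps norm_vector_scalar_mult)

lemma continuous_on_scalar_mult [continuous_intros]:
  "continuous_on S f \<Longrightarrow> continuous_on S (\<lambda>y. f y *s (x::complex^'n))"
  by (rule bounded_linear.continuous_on[OF bounded_linear_scalar_mult_left])

lemma continuous_on_scalar_mult' [continuous_intros]:
  "continuous_on S f \<Longrightarrow> continuous_on S (\<lambda>y. c *s (f y::complex^'n))"
  by (rule bounded_linear.continuous_on[OF bounded_linear_scalar_mult_right])

lemma circle_mean_nonpos:
  assumes "\<And>t. g (cis t) \<le> 0"
  shows "circle_mean g = - (enn2ereal (\<integral>\<^sup>+t\<in>{0..2*pi}. e2ennreal (- g (cis t)) \<partial>lborel) / ereal (2 * pi))"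
proof -
  have "e2ennreal (g (cis t)) = 0" for t using assms by (simp add: e2ennreal_neg)
  then show ?thesis by (simp add: circle_mean_def zero_ennreal.rep_eq)
qed

text \<open>For nonpositive \<open>g\<close> the integral of the positive part vanishes, so no
  difference of possibly infinite terms remains and the inequality can be read in
  \<open>ennreal\<close>.\<close>

lemma le_circle_mean_iff:
  assumes "\<And>t. g (cis t) \<le> 0" "x \<le> 0"
  shows "x \<le> circle_mean g \<longleftrightarrow>
    (\<integral>\<^sup>+t\<in>{0..2*pi}. e2ennreal (- g (cis t)) \<partial>lborel) \<le> e2ennreal (ereal (2 * pi) * - x)"
proof -
  define I where "I = (\<integral>\<^sup>+t\<in>{0..2*pi}. e2ennreal (- g (cis t)) \<partial>lborel)"
  have "x \<le> - (enn2ereal I / ereal (2 * pi)) \<longleftrightarrow> I \<le> e2ennreal (ereal (2 * pi) * - x)"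
  proof (cases x)
    case (real r)
    then show ?thesis
    proof (cases I)
      case (real i)
      then show ?thesis using \<open>x = ereal r\<close> assms(2)
        by (simp add: enn2ereal_ennreal field_simps ennreal_le_iff mult_nonneg_nonpos) linarith
    next
      case top
      then show ?thesis using real by (simp add: top_unique)
    qed
  next
    case MInf then show ?thesis by simp
  qed (use assms in auto)
  then show ?thesis unfolding circle_mean_nonpos[of g, OF assms(1)] I_def .
qed

lemma lsc_on_iff_openin:
  "lsc_on K f \<longleftrightarrow> (\<forall>c. openin (top_of_set K) {x\<in>K. c < f x})"
proof
  assume L: "lsc_on K f"
  show "\<forall>c. openin (top_of_set K) {x\<in>K. c < f x}"
  proof
    fix c
    have "\<exists>U. open U \<and> x \<in> U \<and> (\<forall>y\<in>U\<inter>K. c < f y)" if xc: "x \<in> K" "c < f x" for x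
    proof -
      obtain U where "open U" "x \<in> U" "\<forall>y\<in>U. y \<noteq> x \<longrightarrow> y \<in> K \<longrightarrow> c < f y"
        using L[unfolded lsc_on_def eventually_at_topological, rule_format, OF xc] by blast
      then show ?thesis using xc by (intro exI[of _ U]) auto
    qed
    then have "{x\<in>K. c < f x} = K \<inter> \<Union>{U. open U \<and> (\<forall>y\<in>U\<inter>K. c < f y)}"
      by (intro equalityI subsetI) (simp, blast, blast)
    then show "openin (top_of_set K) {x\<in>K. c < f x}"
      unfolding openin_open by (intro exI[of _ "\<Union>{U. open U \<and> (\<forall>y\<in>U\<inter>K. c < f y)}"]) auto
  qed
next
  assume R: "\<forall>c. openin (top_of_set K) {x\<in>K. c < f x}"
  show "lsc_on K f"
    unfolding lsc_on_def
  proof (intro ballI allI impI)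
    fix x c assume "x \<in> K" "c < f x"
    moreover obtain U where "open U" "{x\<in>K. c < f x} = K \<inter> U" 
      using R[rule_format, of c] unfolding openin_open by blast
    ultimately show "\<forall>\<^sub>F y in at x within K. c < f y"
      unfolding eventually_at_topological by blast
  qed
qed

text \<open>The form in which plurisubharmonicity is used and verified from here on: every function
  concerned is nonpositive, and both conditions on \<open>- u\<close> fit minima and Fatou's
  lemma.\<close>

lemma psh_on_nonpos_iff:
  fixes \<Omega> :: "(complex^'n) set"
  assumes "\<And>w. w \<in> \<Omega> \<Longrightarrow> u w \<le> 0"
  shows "psh_on u \<Omega> \<longleftrightarrow> lsc_on \<Omega> (\<lambda>w. - u w) \<and>
    (\<forall>a b. (\<forall>\<zeta>. norm \<zeta> \<le> 1 \<longrightarrow> a + \<zeta> *s b \<in> \<Omega>) \<longrightarrow>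
      (\<integral>\<^sup>+t\<in>{0..2*pi}. e2ennreal (- u (a + cis t *s b)) \<partial>lborel) \<le> e2ennreal (ereal (2 * pi) * - u a))"
proof -
  have 1: "u a \<le> circle_mean (\<lambda>\<zeta>. u (a + \<zeta> *s b)) \<longleftrightarrow>
      (\<integral>\<^sup>+t\<in>{0..2*pi}. e2ennreal (- u (a + cis t *s b)) \<partial>lborel) \<le> e2ennreal (ereal (2 * pi) * - u a)"
    if "\<forall>\<zeta>. norm \<zeta> \<le> 1 \<longrightarrow> a + \<zeta> *s b \<in> \<Omega>" for a b
  proof -
    have "a + 0 *s b \<in> \<Omega>" using that norm_zero zero_le_one by metis
    then show ?thesis using that assms by (intro le_circle_mean_iff) auto
  qed
  have 2: "(\<forall>c. openin (top_of_set \<Omega>) {w\<in>\<Omega>. u w < c}) \<longleftrightarrow> lsc_on \<Omega> (\<lambda>w. - u w)"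
  proof -
    have eq: "{w\<in>\<Omega>. c < - u w} = {w\<in>\<Omega>. u w < - c}" for c
      using ereal_less_uminus_reorder by blast
    show ?thesis unfolding lsc_on_iff_openin eq
    proof (intro iffI allI)
      fix c assume R: "\<forall>c. openin (top_of_set \<Omega>) {w\<in>\<Omega>. u w < - c}"
      show "openin (top_of_set \<Omega>) {w\<in>\<Omega>. u w < c}" using R[rule_format, of "- c"] by simp
    qed blast
  qed
  have "\<forall>w\<in>\<Omega>. u w < \<infinity>" using assms by fastforce
  then show ?thesis unfolding psh_on_def 2 using 1 by blast
qed

section \<open>Competitors of the Green function on complex lines\<close>

definition green_family :: "(complex^'n) set \<Rightarrow> complex^'n \<Rightarrow> (complex^'n \<Rightarrow> ereal) set" where
  "green_family \<Omega> z = {u \<in> PSH_neg \<Omega>.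
     Limsup (at z within \<Omega>) (\<lambda>\<zeta>. u \<zeta> - ereal (ln (norm (\<zeta> - z)))) < \<infinity>}"

lemma green_eq_SUP: "green \<Omega> z w = (SUP u\<in>green_family \<Omega> z. u w)"
  by (simp add: green_def green_family_def)

lemma green_family_pole:
  assumes "u \<in> green_family \<Omega> z"
  obtains C where "\<forall>\<^sub>F w in at z within \<Omega>. u w \<le> ereal (ln (norm (w - z)) + C)"
proof -
  have "Limsup (at z within \<Omega>) (\<lambda>\<zeta>. u \<zeta> - ereal (ln (norm (\<zeta> - z)))) < \<infinity>"
    using assms by (simp add: green_family_def)
  then obtain C where "Limsup (at z within \<Omega>) (\<lambda>\<zeta>. u \<zeta> - ereal (ln (norm (\<zeta> - z)))) < ereal C"
    using ereal_dense2 by blast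
  from Limsup_lessD[OF this] have "\<forall>\<^sub>F w in at z within \<Omega>. u w \<le> ereal (ln (norm (w - z)) + C)"
  proof eventually_elim
    case (elim w)
    then show ?case by (cases "u w") auto
  qed
  then show thesis by (rule that)
qed

lemma green_familyI:
  assumes "u \<in> PSH_neg \<Omega>" "\<forall>\<^sub>F w in at z within \<Omega>. u w \<le> ereal (ln (norm (w - z)) + C)"
  shows "u \<in> green_family \<Omega> z"
proof -
  have "\<forall>\<^sub>F w in at z within \<Omega>. u w - ereal (ln (norm (w - z))) \<le> ereal C"
    using assms(2)
  proof eventually_elim
    case (elim w)
    then show ?case by (cases "u w") auto
  qed
  then have "Limsup (at z within \<Omega>) (\<lambda>\<zeta>. u \<zeta> - ereal (ln (norm (\<zeta> - z)))) \<le> ereal C"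
    by (rule Limsup_bounded)
  also have "\<dots> < \<infinity>" by simp
  finally show ?thesis using assms(1) by (simp add: green_family_def)
qed

lemma green_family_slice_super:
  assumes u: "u \<in> PSH_neg \<Omega>" and disc: "\<And>\<zeta>. \<zeta> \<in> cball a \<rho> \<Longrightarrow> z + \<zeta> *s X \<in> \<Omega>" and "0 < \<rho>"
  shows "(\<integral>\<^sup>+t\<in>{0..2*pi}. e2ennreal (- u (z + (a + of_real \<rho> * cis t) *s X)) \<partial>lborel)
    \<le> e2ennreal (ereal (2 * pi) * - u (z + a *s X))"
proof -
  have u': "psh_on u \<Omega>" "\<And>w. w \<in> \<Omega> \<Longrightarrow> u w \<le> 0" using u by (auto simp: PSH_neg_def less_imp_le)
  have eq: "(z + a *s X) + \<zeta> *s (of_real \<rho> *s X) = z + (a + of_real \<rho> * \<zeta>) *s X" for \<zeta>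
    by (simp add: vec_eq_iff algebra_simps)
  have "\<forall>\<zeta>. norm \<zeta> \<le> 1 \<longrightarrow> (z + a *s X) + \<zeta> *s (of_real \<rho> *s X) \<in> \<Omega>"
    unfolding eq
  proof (intro allI impI disc)
    fix \<zeta> :: complex assume "norm \<zeta> \<le> 1"
    then show "a + of_real \<rho> * \<zeta> \<in> cball a \<rho>" using \<open>0 < \<rho>\<close> by (simp add: dist_norm norm_mult mult_left_le)
  qed
  then have "(\<integral>\<^sup>+t\<in>{0..2*pi}. e2ennreal (- u ((z + a *s X) + cis t *s (of_real \<rho> *s X))) \<partial>lborel)
      \<le> e2ennreal (ereal (2 * pi) * - u (z + a *s X))"
    using u' psh_on_nonpos_iff[of \<Omega> u] by blast
  then show ?thesis unfolding eq .
qed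

lemma lsc_on_compose:
  assumes "lsc_on K f" "continuous_on L g" "g ` L \<subseteq> K"
  shows "lsc_on L (\<lambda>x. f (g x))"
proof -
  have "openin (top_of_set L) {x \<in> L. c < f (g x)}" for c
  proof -
    have "openin (top_of_set L) (L \<inter> g -` {y \<in> K. c < f y})"
      using assms by (intro continuous_openin_preimage[of _ _ K]) (auto simp: lsc_on_iff_openin)
    moreover have "L \<inter> g -` {y \<in> K. c < f y} = {x \<in> L. c < f (g x)}" using assms(3) by auto
    ultimately show ?thesis by simp
  qed
  then show ?thesis by (auto simp: lsc_on_iff_openin)
qed

text \<open>On the slice, \<open>- u\<close> has a logarithmic pole with constant
  \<open>C + ln (norm X)\<close>, which depends on \<open>u\<close>. The comparison accepts any
  constant and does not return it, so the bound will survive the supremum over all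
  competitors.\<close>

lemma green_family_slice_le:
  assumes u: "u \<in> green_family \<Omega> z" and "X \<noteq> 0" "0 < r"
    and disc: "\<And>\<zeta>. norm \<zeta> \<le> r \<Longrightarrow> z + \<zeta> *s X \<in> \<Omega>"
    and F: "continuous_on (cball 0 r) F" "F holomorphic_on ball 0 r"
    and bd: "\<And>\<zeta>. norm \<zeta> = r \<Longrightarrow> u (z + \<zeta> *s X) \<le> ereal (Re (F \<zeta>))"
    and \<zeta>: "0 < norm \<zeta>" "norm \<zeta> \<le> r"
  shows "u (z + \<zeta> *s X) \<le> ereal (ln (norm \<zeta> / r) + Re (F \<zeta>))"
proof -
  have u': "u \<in> PSH_neg \<Omega>" "psh_on u \<Omega>" "\<And>w. w \<in> \<Omega> \<Longrightarrow> u w \<le> 0"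
    using u by (auto simp: PSH_neg_def green_family_def less_imp_le)
  then have lsc: "lsc_on \<Omega> (\<lambda>w. - u w)" using psh_on_nonpos_iff[of \<Omega> u] by blast
  obtain C where C: "\<forall>\<^sub>F w in at z within \<Omega>. u w \<le> ereal (ln (norm (w - z)) + C)"
    using green_family_pole[OF u] .
  have c: "continuous_on S (\<lambda>\<zeta>. z + \<zeta> *s X)" for S by (intro continuous_intros)
  have "((\<lambda>\<zeta>. z + \<zeta> *s X) \<longlongrightarrow> z + 0 *s X) (at 0)"
    by (intro tendsto_intros bounded_linear.tendsto[OF bounded_linear_scalar_mult_left])
  moreover have "\<forall>\<^sub>F \<zeta> in at 0. z + \<zeta> *s X \<in> \<Omega> \<and> z + \<zeta> *s X \<noteq> z"
    using \<open>0 < r\<close> \<open>X \<noteq> 0\<close> disc by (auto simp: eventually_at intro!: exI[of _ r])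
  ultimately have fl: "filterlim (\<lambda>\<zeta>. z + \<zeta> *s X) (at z within \<Omega>) (at 0)"
    by (auto simp: filterlim_at)
  have "\<forall>\<^sub>F \<zeta> in at 0. \<zeta> \<noteq> (0::complex)" by (auto simp: eventually_at intro!: exI[of _ 1])
  with filterlim_iff[THEN iffD1, OF fl, rule_format, OF C]
  have pole: "\<forall>\<^sub>F \<zeta> in at 0. ereal (- ln (norm \<zeta>) - (C + ln (norm X))) \<le> - u (z + \<zeta> *s X)"
  proof eventually_elim
    case (elim \<zeta>)
    then have "ln (norm (z + \<zeta> *s X - z)) = ln (norm \<zeta>) + ln (norm X)"
      using \<open>X \<noteq> 0\<close> by (simp add: norm_vector_scalar_mult ln_mult)
    with elim(1) show ?case by (cases "u (z + \<zeta> *s X)") auto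
  qed
  have "ereal (ln (r / norm \<zeta>) - Re (F \<zeta>)) \<le> - u (z + \<zeta> *s X)"
  proof (rule superharmonic_pole_minorant[OF \<open>0 < r\<close> _ _ _ pole F _ \<zeta>])
    show "lsc_on (cball 0 r - {0}) (\<lambda>\<zeta>. - u (z + \<zeta> *s X))"
      using disc by (intro lsc_on_compose[OF lsc c]) auto
    show "0 \<le> - u (z + \<zeta> *s X)" if "\<zeta> \<in> cball 0 r - {0}" for \<zeta>
      using that disc u'(3) by (simp add: ereal_0_le_uminus_iff)
    show "ereal (- Re (F \<zeta>)) \<le> - u (z + \<zeta> *s X)" if "norm \<zeta> = r" for \<zeta>
      using bd[OF that] by (cases "u (z + \<zeta> *s X)") auto
    show "(\<integral>\<^sup>+t\<in>{0..2*pi}. e2ennreal (- u (z + (a + of_real \<rho> * cis t) *s X)) \<partial>lborel)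
        \<le> e2ennreal (ereal (2 * pi) * - u (z + a *s X))"
      if "0 < \<rho>" "cball a \<rho> \<subseteq> ball 0 r - {0}" for a \<rho>
    proof (rule green_family_slice_super[OF u'(1) _ \<open>0 < \<rho>\<close>])
      fix \<zeta> assume "\<zeta> \<in> cball a \<rho>"
      then have "norm \<zeta> < r" using that by auto
      then show "z + \<zeta> *s X \<in> \<Omega>" by (intro disc) simp
    qed
  qed
  moreover have "ln (r / norm \<zeta>) = - ln (norm \<zeta> / r)" using \<zeta> \<open>0 < r\<close> by (simp add: ln_div)
  ultimately show ?thesis by (cases "u (z + \<zeta> *s X)") auto
qed

text \<open>The closed disc of radius \<open>r\<close> may leave \<open>\<Omega>\<close>, so the
  comparison with \<open>F = 0\<close> is made on discs of radius \<rho> < r, and \<rho> tends to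
  \<open>r\<close>.\<close>

lemma green_family_le_ln:
  assumes u: "u \<in> green_family \<Omega> z" and "X \<noteq> 0" "0 < r"
    and disc: "\<And>\<zeta>. norm \<zeta> < r \<Longrightarrow> z + \<zeta> *s X \<in> \<Omega>" and \<zeta>: "0 < norm \<zeta>" "norm \<zeta> < r"
  shows "u (z + \<zeta> *s X) \<le> ereal (ln (norm \<zeta> / r))"
proof -
  have neg: "u w \<le> 0" if "w \<in> \<Omega>" for w using u that by (auto simp: PSH_neg_def green_family_def less_imp_le)
  have *: "u (z + \<zeta> *s X) \<le> ereal (ln (norm \<zeta> / \<rho>))" if "norm \<zeta> < \<rho>" "\<rho> < r" for \<rho>
    using green_family_slice_le[OF u \<open>X \<noteq> 0\<close>, of \<rho> "\<lambda>_. 0" \<zeta>] that \<zeta> disc neg by (simp add: zero_ereal_def)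
  show ?thesis
  proof (rule tendsto_lowerbound)
    show "((\<lambda>\<rho>. ereal (ln (norm \<zeta> / \<rho>))) \<longlongrightarrow> ereal (ln (norm \<zeta> / r))) (at_left r)"
      using \<zeta> by (intro tendsto_intros) auto
    show "\<forall>\<^sub>F \<rho> in at_left r. u (z + \<zeta> *s X) \<le> ereal (ln (norm \<zeta> / \<rho>))"
      using * \<zeta>(2) by (auto simp: eventually_at_left_field)
  qed simp
qed

section \<open>Upper semicontinuity of the Green function\<close>

lemma green_nonpos: "w \<in> \<Omega> \<Longrightarrow> green \<Omega> z w \<le> 0"
  unfolding green_eq_SUP by (rule SUP_least) (auto simp: green_family_def PSH_neg_def less_imp_le)

lemma add_in_ball_iff: "z + v \<in> ball z r \<longleftrightarrow> norm (v::'a::real_normed_vector) < r"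
  by (simp add: dist_norm)

text \<open>The direction \<open>w - z\<close> is not normalised: on its line, \<open>w\<close> has
  parameter 1 and the ball cuts out the disc of radius \<open>r / norm (w - z)\<close>.\<close>

lemma green_le_ln:
  assumes "ball z r \<subseteq> \<Omega>" "w \<in> ball z r" "w \<noteq> z"
  shows "green \<Omega> z w \<le> ereal (ln (norm (w - z) / r))"
  unfolding green_eq_SUP
proof (rule SUP_least)
  fix u assume u: "u \<in> green_family \<Omega> z"
  have n: "0 < norm (w - z)" "norm (w - z) < r" using assms by (auto simp: dist_norm norm_minus_commute)
  have "0 < r / norm (w - z)" using order.strict_trans[OF n] n(1) by (rule divide_pos_pos)
  have "u (z + 1 *s (w - z)) \<le> ereal (ln (norm (1::complex) / (r / norm (w - z))))"
  proof (rule green_family_le_ln[OF u])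
    fix \<zeta> :: complex assume "norm \<zeta> < r / norm (w - z)"
    then have "z + \<zeta> *s (w - z) \<in> ball z r"
      using n unfolding add_in_ball_iff by (simp only: norm_vector_scalar_mult pos_less_divide_eq)
    then show "z + \<zeta> *s (w - z) \<in> \<Omega>" using assms by blast
  qed (use n \<open>0 < r / norm (w - z)\<close> assms in auto)
  then show "u w \<le> ereal (ln (norm (w - z) / r))" using n by simp
qed

lemma lsc_on_UNIV_iff: "lsc_on UNIV f \<longleftrightarrow> (\<forall>c. open {x. c < f x})"
  by (simp add: lsc_on_iff_openin)

text \<open>Superlevel sets of the truncated function are superlevel sets of the original one, since
  thresholds in \<open>ennreal\<close> are never negative. Hence truncation keeps lower
  semicontinuity.\<close>

lemma less_e2ennreal_iff: "c < e2ennreal y \<longleftrightarrow> enn2ereal c < y"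
proof (cases "0 \<le> y")
  case True
  then have "c < e2ennreal y \<longleftrightarrow> enn2ereal c < enn2ereal (e2ennreal y)" by (simp add: less_ennreal.rep_eq)
  with True show ?thesis by (simp add: enn2ereal_e2ennreal)
next
  case False
  then have "e2ennreal y = 0" by (simp add: e2ennreal_neg)
  moreover have "\<not> enn2ereal c < y" using False enn2ereal_nonneg[of c] by (meson less_imp_le less_le_trans not_le order_trans)
  ultimately show ?thesis by simp
qed

lemma lsc_on_UNIV_e2ennreal:
  assumes "lsc_on UNIV f"
  shows "lsc_on UNIV (\<lambda>x. e2ennreal (f x))"
  using assms unfolding lsc_on_UNIV_iff less_e2ennreal_iff by blast

lemma lsc_on_UNIV_le_liminf:
  fixes f :: "'a::topological_space \<Rightarrow> 'b::complete_linorder"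
  assumes "lsc_on UNIV f" "X \<longlonglongrightarrow> x"
  shows "f x \<le> liminf (\<lambda>n. f (X n))"
  unfolding le_Liminf_iff
proof (intro allI impI)
  fix c assume "c < f x"
  then show "\<forall>\<^sub>F n in sequentially. c < f (X n)"
    using topological_tendstoD[OF assms(2), of "{x. c < f x}"] assms(1) by (auto simp: lsc_on_UNIV_iff)
qed

lemma borel_measurable_lsc:
  fixes f :: "'a::topological_space \<Rightarrow> 'b::{linorder_topology, second_countable_topology}"
  assumes "lsc_on UNIV f"
  shows "f \<in> borel_measurable borel"
  by (rule borel_measurableI_greater) (use assms in \<open>auto simp: lsc_on_UNIV_iff\<close>)

text \<open>The Green function equals its upper semicontinuous regularization \<open>V\<close>: by Fatou's lemma \<open>V\<close>
  inherits the sub-mean value property, so \<open>V - \<epsilon>\<close> competes in the supremum. The shift by \<open>\<epsilon>\<close>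
  secures strict negativity.\<close>

definition green_reg :: "(complex^'n) set \<Rightarrow> complex^'n \<Rightarrow> complex^'n \<Rightarrow> ereal" where
  "green_reg \<Omega> z w = Limsup (nhds w) (green \<Omega> z)"

lemma green_le_green_reg: "green \<Omega> z w \<le> green_reg \<Omega> z w"
proof (rule ccontr)
  assume "\<not> ?thesis"
  then have "green_reg \<Omega> z w < green \<Omega> z w" by simp
  from Limsup_lessD[OF this[unfolded green_reg_def]] show False
    by (auto simp: eventually_nhds)
qed

lemma green_reg_le:
  assumes "\<forall>\<^sub>F y in nhds w. green \<Omega> z y \<le> c"
  shows "green_reg \<Omega> z w \<le> c"
  unfolding green_reg_def using assms by (rule Limsup_bounded)

text \<open>A limit superior over \<open>nhds\<close> is upper semicontinuous everywhere, even where
  \<open>green\<close> is meaningless. The global form makes the functions on circles Borel without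
  restriction to \<open>\<Omega>\<close>.\<close>

lemma lsc_green_reg: "lsc_on UNIV (\<lambda>w. - green_reg \<Omega> z w)"
  unfolding lsc_on_UNIV_iff
proof
  fix c
  show "open {w. c < - green_reg \<Omega> z w}"
  proof (rule topological_space_class.openI)
    fix w assume "w \<in> {w. c < - green_reg \<Omega> z w}"
    then have "green_reg \<Omega> z w < - c" using ereal_less_uminus_reorder by blast
    then obtain d where d: "green_reg \<Omega> z w < d" "d < - c" using dense by blast
    from Limsup_lessD[OF d(1)[unfolded green_reg_def]]
    obtain S where S: "open S" "w \<in> S" "\<And>y. y \<in> S \<Longrightarrow> green \<Omega> z y < d" by (auto simp: eventually_nhds)
    have "c < - green_reg \<Omega> z y" if "y \<in> S" for y
    proof -
      have "green_reg \<Omega> z y \<le> d"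
        using S that by (intro green_reg_le) (auto simp: eventually_nhds less_imp_le intro!: exI[of _ S])
      with d(2) show ?thesis using ereal_less_uminus_reorder order_le_less_trans by blast
    qed
    with S show "\<exists>T. open T \<and> w \<in> T \<and> T \<subseteq> {w. c < - green_reg \<Omega> z w}" by blast
  qed
qed

text \<open>Suppose the circle integral \<open>\<Phi> a\<close> exceeds some \<open>d\<close> above
  the right-hand side. By Fatou, \<open>\<Phi> y\<close> exceeds \<open>d\<close> for
  \<open>y\<close> near \<open>a\<close>. Every competitor \<open>u\<close> lies below the
  regularization, so its own mean value inequality at \<open>y\<close> forces u(y) \<le> -d / (2
  pi), uniformly in \<open>u\<close> and \<open>y\<close>. Supremum and limit superior preserve
  this, a contradiction at \<open>a\<close>. The Green function itself is never integrated.\<close>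

lemma green_reg_super:
  assumes "open \<Omega>" and disc: "\<And>\<zeta>. norm \<zeta> \<le> 1 \<Longrightarrow> a + \<zeta> *s b \<in> \<Omega>"
  shows "(\<integral>\<^sup>+t\<in>{0..2*pi}. e2ennreal (- green_reg \<Omega> z (a + cis t *s b)) \<partial>lborel)
    \<le> e2ennreal (ereal (2 * pi) * - green_reg \<Omega> z a)"
proof (rule ccontr)
  define h where "h w = e2ennreal (- green_reg \<Omega> z w)" for w
  define \<Phi> where "\<Phi> y = (\<integral>\<^sup>+t\<in>{0..2*pi}. h (y + cis t *s b) \<partial>lborel)" for y
  have h: "lsc_on UNIV h" unfolding h_def by (intro lsc_on_UNIV_e2ennreal lsc_green_reg)
  have meas: "(\<lambda>t. h (y + cis t *s b)) \<in> borel_measurable borel" for y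
  proof (rule borel_measurable_lsc)
    show "lsc_on UNIV (\<lambda>t. h (y + cis t *s b))"
      by (rule lsc_on_compose[OF h]) (auto intro!: continuous_intros)
  qed
  assume "\<not> ?thesis"
  then have "e2ennreal (ereal (2 * pi) * - green_reg \<Omega> z a) < \<Phi> a"
    by (simp add: \<Phi>_def h_def)
  then obtain d where d: "e2ennreal (ereal (2 * pi) * - green_reg \<Omega> z a) < d" "d < \<Phi> a"
    using dense by blast
  have "d < top" using d(2) top_greatest by (rule less_le_trans)
  then obtain \<delta> where \<delta>: "d = ennreal \<delta>" "0 \<le> \<delta>" by (cases d) auto
  have 1: "\<forall>\<^sub>F y in nhds a. d < \<Phi> y"
    unfolding eventually_nhds_iff_sequentially
  proof (intro allI impI)
    fix X assume X: "X \<longlonglongrightarrow> a"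
    have "\<Phi> a \<le> (\<integral>\<^sup>+t\<in>{0..2*pi}. liminf (\<lambda>n. h (X n + cis t *s b)) \<partial>lborel)"
      unfolding \<Phi>_def
      by (intro nn_integral_mono mult_right_mono lsc_on_UNIV_le_liminf[OF h] tendsto_intros X) auto
    also have "\<dots> = (\<integral>\<^sup>+t. liminf (\<lambda>n. h (X n + cis t *s b) * indicator {0..2*pi} t) \<partial>lborel)"
      by (intro nn_integral_cong) (auto simp: indicator_def Liminf_const)
    also have "\<dots> \<le> liminf (\<lambda>n. \<Phi> (X n))"
      unfolding \<Phi>_def using meas by (intro nn_integral_liminf borel_measurable_times) auto
    finally show "\<forall>\<^sub>F n in sequentially. d < \<Phi> (X n)"
      using d(2) by (intro less_LiminfD) (rule order.strict_trans2)
  qed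
  \<comment> \<open>The closed disc is compact in the open set, so its translates to centres
    \<open>y\<close> near \<open>a\<close> still lie in \<open>\<Omega>\<close> and the competitors
    may be averaged over them.\<close>
  have "compact ((\<lambda>\<zeta>. a + \<zeta> *s b) ` cball 0 1)"
    by (intro compact_continuous_image continuous_intros) auto
  then obtain e where e: "e > 0" "(\<Union>x\<in>(\<lambda>\<zeta>. a + \<zeta> *s b) ` cball 0 1. ball x e) \<subseteq> \<Omega>"
    using compact_subset_open_imp_ball_epsilon_subset[OF _ \<open>open \<Omega>\<close>] disc by (metis image_subsetI mem_cball_0)
  have 2: "\<forall>\<^sub>F y in nhds a. dist y a < e" using e(1) by (auto simp: eventually_nhds_metric)
  have "\<forall>\<^sub>F y in nhds a. green \<Omega> z y \<le> ereal (- \<delta> / (2 * pi))"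
    using 1 2
  proof eventually_elim
    case (elim y)
    show ?case unfolding green_eq_SUP
    proof (rule SUP_least)
      fix u assume u: "u \<in> green_family \<Omega> z"
      have ug: "u w \<le> green_reg \<Omega> z w" for w
        using u green_le_green_reg by (metis SUP_upper green_eq_SUP order_trans)
      have u': "psh_on u \<Omega>" "\<And>w. w \<in> \<Omega> \<Longrightarrow> u w \<le> 0"
        using u by (auto simp: PSH_neg_def green_family_def less_imp_le)
      have "y + \<zeta> *s b \<in> \<Omega>" if "norm \<zeta> \<le> 1" for \<zeta>
      proof -
        have "y + \<zeta> *s b \<in> ball (a + \<zeta> *s b) e" using elim(2) by (simp add: dist_norm norm_minus_commute)
        with e that show ?thesis by fastforce
      qed
      then have "(\<integral>\<^sup>+t\<in>{0..2*pi}. e2ennreal (- u (y + cis t *s b)) \<partial>lborel) \<le> e2ennreal (ereal (2 * pi) * - u y)"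
        using u' psh_on_nonpos_iff[of \<Omega> u] by blast
      moreover have "\<Phi> y \<le> (\<integral>\<^sup>+t\<in>{0..2*pi}. e2ennreal (- u (y + cis t *s b)) \<partial>lborel)"
        unfolding \<Phi>_def h_def using ug by (intro nn_integral_mono mult_right_mono e2ennreal_mono) auto
      ultimately have "d < e2ennreal (ereal (2 * pi) * - u y)" using elim(1) by order
      then have "ereal \<delta> < ereal (2 * pi) * - u y" using \<delta> by (simp add: less_e2ennreal_iff enn2ereal_ennreal)
      then show "u y \<le> ereal (- \<delta> / (2 * pi))" by (cases "u y") (auto simp: field_simps)
    qed
  qed
  then have "green_reg \<Omega> z a \<le> ereal (- \<delta> / (2 * pi))" by (rule green_reg_le)
  then have "ereal \<delta> \<le> ereal (2 * pi) * - green_reg \<Omega> z a"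
    by (cases "green_reg \<Omega> z a") (auto simp: field_simps)
  from e2ennreal_mono[OF this] have "d \<le> e2ennreal (ereal (2 * pi) * - green_reg \<Omega> z a)"
    using \<delta> by simp
  with d(1) show False by simp
qed

lemma green_reg_eq_green:
  assumes "open \<Omega>" "z \<in> \<Omega>" "w \<in> \<Omega>"
  shows "green_reg \<Omega> z w = green \<Omega> z w"
proof (rule antisym)
  have nonpos: "green_reg \<Omega> z x \<le> 0" if "x \<in> \<Omega>" for x
    using assms(1) that by (intro green_reg_le) (auto simp: eventually_nhds intro!: green_nonpos exI[of _ \<Omega>])
  obtain r where r: "r > 0" "ball z r \<subseteq> \<Omega>" using assms by (auto simp: open_contains_ball)
  \<comment> \<open>Regularization keeps the pole, because the majorant of \<open>green\<close> near
    \<open>z\<close> is continuous away from \<open>z\<close>.\<close>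
  have pole: "green_reg \<Omega> z x \<le> ereal (ln (norm (x - z)) - ln r)" if x: "x \<in> ball z r" "x \<noteq> z" for x
  proof -
    have op: "open (ball z r - {z})" by (intro open_delete) auto
    have "((\<lambda>y. ereal (ln (norm (y - z) / r))) \<longlongrightarrow> ereal (ln (norm (x - z) / r))) (nhds x)"
      using r x by (intro tendsto_intros filterlim_ident) auto
    then have "Limsup (nhds x) (\<lambda>y. ereal (ln (norm (y - z) / r))) = ereal (ln (norm (x - z) / r))"
      by (intro lim_imp_Limsup) auto
    moreover have "green_reg \<Omega> z x \<le> Limsup (nhds x) (\<lambda>y. ereal (ln (norm (y - z) / r)))"
      unfolding green_reg_def
    proof (rule Limsup_mono)
      show "\<forall>\<^sub>F y in nhds x. green \<Omega> z y \<le> ereal (ln (norm (y - z) / r))"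
        unfolding eventually_nhds using op x r by (intro exI[of _ "ball z r - {z}"]) (auto intro!: green_le_ln)
    qed
    ultimately show ?thesis using x r by (simp add: ln_div)
  qed
  have fam: "(\<lambda>x. green_reg \<Omega> z x - ereal \<epsilon>) \<in> green_family \<Omega> z" if "\<epsilon> > 0" for \<epsilon>
  proof (rule green_familyI)
    have neg: "green_reg \<Omega> z x - ereal \<epsilon> < 0" if "x \<in> \<Omega>" for x
      using nonpos[OF that] \<open>\<epsilon> > 0\<close> by (cases "green_reg \<Omega> z x") auto
    have "psh_on (\<lambda>x. green_reg \<Omega> z x - ereal \<epsilon>) \<Omega>"
    proof (subst psh_on_nonpos_iff, goal_cases)
      case (1 x) then show ?case using neg by (simp add: less_imp_le)
    next
      case 2
      show ?case
      proof (intro conjI allI impI)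
        have eq: "- (green_reg \<Omega> z x - ereal \<epsilon>) = - green_reg \<Omega> z x + ereal \<epsilon>" for x
          by (cases "green_reg \<Omega> z x") auto
        show "lsc_on \<Omega> (\<lambda>x. - (green_reg \<Omega> z x - ereal \<epsilon>))"
          unfolding eq using nonpos
          by (intro lsc_on_add_real lsc_on_subset[OF lsc_green_reg]) (auto, force)
        fix a b assume disc: "\<forall>\<zeta>. norm \<zeta> \<le> 1 \<longrightarrow> a + \<zeta> *s b \<in> \<Omega>"
        have sh: "e2ennreal (x + ereal e) = e2ennreal x + ennreal e" if "0 \<le> x" "0 \<le> e" for x e
          using that by (cases x) (auto simp: ennreal_plus)
        have aO: "a \<in> \<Omega>" using disc[rule_format, of 0] by simp
        have "0 \<le> ereal (2 * pi) * - green_reg \<Omega> z a"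
          using nonpos[OF aO] by (cases "green_reg \<Omega> z a") (auto simp: mult_nonneg_nonpos)
        have meas: "(\<lambda>t. e2ennreal (- green_reg \<Omega> z (a + cis t *s b))) \<in> borel_measurable borel"
        proof (rule borel_measurable_lsc)
          show "lsc_on UNIV (\<lambda>t. e2ennreal (- green_reg \<Omega> z (a + cis t *s b)))"
            by (rule lsc_on_compose[OF lsc_on_UNIV_e2ennreal[OF lsc_green_reg]]) (auto intro!: continuous_intros)
        qed
        have "(\<integral>\<^sup>+t\<in>{0..2*pi}. e2ennreal (- (green_reg \<Omega> z (a + cis t *s b) - ereal \<epsilon>)) \<partial>lborel) =
          (\<integral>\<^sup>+t. e2ennreal (- green_reg \<Omega> z (a + cis t *s b)) * indicator {0..2*pi} t + ennreal \<epsilon> * indicator {0..2*pi} t \<partial>lborel)"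
          unfolding eq using disc nonpos \<open>\<epsilon> > 0\<close>
          by (intro nn_integral_cong) (auto simp: indicator_def sh ereal_0_le_uminus_iff)
        also have "\<dots> = (\<integral>\<^sup>+t\<in>{0..2*pi}. e2ennreal (- green_reg \<Omega> z (a + cis t *s b)) \<partial>lborel) + ennreal \<epsilon> * ennreal (2 * pi)"
          using meas by (subst nn_integral_add) (auto simp: nn_integral_cmult)
        also have "\<dots> \<le> e2ennreal (ereal (2 * pi) * - green_reg \<Omega> z a) + ennreal \<epsilon> * ennreal (2 * pi)"
          using disc by (intro add_right_mono green_reg_super assms) auto
        also have "\<dots> = e2ennreal (ereal (2 * pi) * - green_reg \<Omega> z a + ereal (2 * pi * \<epsilon>))"
          using \<open>0 \<le> ereal (2 * pi) * - green_reg \<Omega> z a\<close> \<open>\<epsilon> > 0\<close>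
          by (subst sh) (auto simp: ennreal_mult[symmetric] mult_ac)
        also have "\<dots> = e2ennreal (ereal (2 * pi) * - (green_reg \<Omega> z a - ereal \<epsilon>))"
          by (cases "green_reg \<Omega> z a") (auto simp: algebra_simps)
        finally show "(\<integral>\<^sup>+t\<in>{0..2*pi}. e2ennreal (- (green_reg \<Omega> z (a + cis t *s b) - ereal \<epsilon>)) \<partial>lborel)
            \<le> e2ennreal (ereal (2 * pi) * - (green_reg \<Omega> z a - ereal \<epsilon>))" .
      qed
    qed
    with neg show "(\<lambda>x. green_reg \<Omega> z x - ereal \<epsilon>) \<in> PSH_neg \<Omega>" by (auto simp: PSH_neg_def)
    have "\<forall>\<^sub>F x in at z within \<Omega>. dist x z < r \<and> x \<noteq> z"
      using r(1) by (auto simp: eventually_at)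
    then show "\<forall>\<^sub>F x in at z within \<Omega>. green_reg \<Omega> z x - ereal \<epsilon> \<le> ereal (ln (norm (x - z)) + - ln r)"
    proof eventually_elim
      case (elim x)
      then show ?case using pole[of x] \<open>\<epsilon> > 0\<close> by (cases "green_reg \<Omega> z x") (auto simp: dist_commute)
    qed
  qed
  show "green_reg \<Omega> z w \<le> green \<Omega> z w"
  proof (rule ereal_le_epsilon2)
    fix \<epsilon> :: real assume "0 < \<epsilon>"
    have "green_reg \<Omega> z w - ereal \<epsilon> \<le> green \<Omega> z w"
      unfolding green_eq_SUP by (rule SUP_upper2[OF fam[OF \<open>0 < \<epsilon>\<close>]]) simp
    then show "green_reg \<Omega> z w \<le> green \<Omega> z w + ereal \<epsilon>"
      by (simp add: ereal_minus_le_iff)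
  qed
qed (rule green_le_green_reg)

section \<open>The Azukawa indicatrix\<close>

text \<open>Projections of Borel sets need not be Borel. Here the sublevel set is a countable union
  of compact sets: exhaust \<open>U\<close> by compact sets and replace the strict bound by closed
  ones with thresholds \<open>c - 1 / Suc j\<close>. Images of compact sets are compact.\<close>

lemma sets_borel_snd_image_sublevel:
  fixes f :: "'a::euclidean_space \<times> 'b::euclidean_space \<Rightarrow> ereal"
  assumes U: "open U" and f: "lsc_on U f"
  shows "snd ` {p\<in>U. f p < ereal c} \<in> sets borel"
proof -
  obtain K :: "nat \<Rightarrow> ('a \<times> 'b) set" where K: "\<And>i. compact (K i)" "\<And>i. K i \<subseteq> U" "(\<Union>i. K i) = U"
    using open_Union_compact_subsets[OF U] by metis
  have cpt: "compact {p \<in> K i. f p \<le> ereal d}" for i d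
  proof -
    have "openin (top_of_set (K i)) {p \<in> K i. ereal d < f p}"
      using lsc_on_subset[OF f K(2)] by (simp add: lsc_on_iff_openin)
    then have "closedin (top_of_set (K i)) (K i - {p \<in> K i. ereal d < f p})" by (intro closedin_diff) auto
    moreover have "K i - {p \<in> K i. ereal d < f p} = {p \<in> K i. f p \<le> ereal d}" by auto
    ultimately show ?thesis using closedin_compact[OF K(1)] by metis
  qed
  have "f p < ereal c \<longleftrightarrow> (\<exists>j. f p \<le> ereal (c - 1 / real (Suc j)))" for p
  proof
    assume "f p < ereal c"
    then obtain d where d: "f p < ereal d" "ereal d < ereal c" using ereal_dense2 by blast
    then have "0 < c - d" by simp
    then obtain j where "inverse (real (Suc j)) < c - d" using reals_Archimedean by blast
    then have "ereal d \<le> ereal (c - 1 / real (Suc j))" by (simp add: inverse_eq_divide)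
    with d(1) show "\<exists>j. f p \<le> ereal (c - 1 / real (Suc j))" by (meson less_imp_le order_trans)
  next
    assume "\<exists>j. f p \<le> ereal (c - 1 / real (Suc j))"
    then obtain j where "f p \<le> ereal (c - 1 / real (Suc j))" ..
    also have "\<dots> < ereal c" by simp
    finally show "f p < ereal c" .
  qed
  then have "{p\<in>U. f p < ereal c} = (\<Union>i j. {p \<in> K i. f p \<le> ereal (c - 1 / real (Suc j))})"
    unfolding K(3)[symmetric] by auto
  then have "snd ` {p\<in>U. f p < ereal c} = (\<Union>i j. snd ` {p \<in> K i. f p \<le> ereal (c - 1 / real (Suc j))})"
    by (simp only: image_UN)
  also have "\<dots> \<in> sets borel"
    by (intro sets.countable_UN image_subsetI borel_compact compact_continuous_image cpt continuous_intros)
  finally show ?thesis .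
qed

lemma Limsup_less_0E:
  assumes "Limsup F f < (0::ereal)"
  obtains k where "\<forall>\<^sub>F x in F. f x \<le> - ereal (1 / real (Suc k))"
proof -
  obtain d where d: "Limsup F f < ereal d" "ereal d < 0" using ereal_dense2[OF assms] by blast
  then have "0 < - d" by (simp add: zero_ereal_def)
  then obtain k where "inverse (real (Suc k)) < - d" using reals_Archimedean by blast
  then have "ereal d \<le> - ereal (1 / real (Suc k))" by (simp add: inverse_eq_divide)
  with eventually_mono[OF Limsup_lessD[OF d(1)]] that show thesis
    by (meson less_imp_le order_trans)
qed

text \<open>A negative limit superior means a bound \<open>- 1 / Suc k\<close> on some punctured
  disc \<open>D m\<close>, which gives a countable union. For fixed \<open>k\<close> and
  \<open>m\<close> the directions violating the bound form the projection \<open>N k m\<close> of a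
  sublevel set of a function of the pair (\<zeta>, X), lower semicontinuous because the Green
  function is upper semicontinuous.\<close>

lemma sets_borel_azukawa_indicatrix:
  fixes z :: "complex^'n"
  assumes "open \<Omega>" "z \<in> \<Omega>"
  shows "azukawa_indicatrix \<Omega> z \<in> sets borel"
proof -
  obtain r where r: "r > 0" "ball z r \<subseteq> \<Omega>" using assms by (auto simp: open_contains_ball)
  \<comment> \<open>The radii of \<open>D m\<close> and \<open>B m\<close> have product
    \<open>r\<close>, so \<open>z + \<zeta> *s X\<close> stays in \<open>ball z r\<close>; removing
    0 keeps \<open>ln (norm \<zeta>)\<close> continuous.\<close>
  define D where "D m = ball (0::complex) (1 / real (Suc m)) - {0}" for m
  define B where "B m = ball (0::complex^'n) (r * real (Suc m))" for m
  define f where "f p = - green \<Omega> z (z + fst p *s snd p) + ereal (ln (norm (fst p)))" for p :: "complex \<times> (complex^'n)"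
  define N where "N k m = snd ` {p \<in> D m \<times> B m. f p < ereal (1 / real (Suc k))}" for k m
  have mem: "z + \<zeta> *s X \<in> \<Omega>" if "\<zeta> \<in> D m" "X \<in> B m" for \<zeta> X m
  proof -
    have "norm (\<zeta> *s X) = norm \<zeta> * norm X" by (rule norm_vector_scalar_mult)
    also have "\<dots> < (1 / real (Suc m)) * (r * real (Suc m))"
      using that unfolding D_def B_def by (intro mult_strict_mono') auto
    also have "\<dots> = r" by simp
    finally have "z + \<zeta> *s X \<in> ball z r" unfolding add_in_ball_iff .
    with r show ?thesis by blast
  qed
  have "{w \<in> \<Omega>. c < - green_reg \<Omega> z w} = {w \<in> \<Omega>. c < - green \<Omega> z w}" for c
    using green_reg_eq_green[OF assms] by auto
  then have lsc: "lsc_on \<Omega> (\<lambda>w. - green \<Omega> z w)"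
    using lsc_on_subset[OF lsc_green_reg[of \<Omega> z] subset_UNIV[of \<Omega>]] by (simp add: lsc_on_iff_openin)
  have Nm: "N k m \<in> sets borel" for k m
    unfolding N_def
  proof (rule sets_borel_snd_image_sublevel)
    show "open (D m \<times> B m)" unfolding D_def B_def by (intro open_Times open_delete open_ball)
    have "continuous_on (D m \<times> B m) (\<lambda>p. fst p *s snd p)"
      unfolding vector_scalar_mult_def by (intro continuous_intros)
    then have "lsc_on (D m \<times> B m) (\<lambda>p. - green \<Omega> z (z + fst p *s snd p))"
      using mem by (intro lsc_on_compose[OF lsc] continuous_intros) auto
    then show "lsc_on (D m \<times> B m) f"
      unfolding f_def
    proof (rule lsc_on_add_real)
      fix p assume "p \<in> D m \<times> B m"
      then have "green \<Omega> z (z + fst p *s snd p) \<le> 0" using mem by (intro green_nonpos) auto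
      then show "- green \<Omega> z (z + fst p *s snd p) \<noteq> - \<infinity>" by auto
    qed (auto simp: D_def intro!: continuous_intros)
  qed
  have Bm: "B m \<in> sets borel" for m by (simp add: B_def)
  have eq: "azukawa_indicatrix \<Omega> z = (\<Union>k m. B m - N k m)"
  proof -
    have fle: "ereal q \<le> f (\<zeta>, X) \<longleftrightarrow> green \<Omega> z (z + \<zeta> *s X) - ereal (ln (norm \<zeta>)) \<le> - ereal q" for q \<zeta> X
      unfolding f_def by (cases "green \<Omega> z (z + \<zeta> *s X)") auto
    have N: "X \<in> B m - N k m \<longleftrightarrow> X \<in> B m \<and>
       (\<forall>\<zeta>\<in>D m. green \<Omega> z (z + \<zeta> *s X) - ereal (ln (norm \<zeta>)) \<le> - ereal (1 / real (Suc k)))" for X k m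
      unfolding N_def fle[symmetric] by (auto simp: image_iff not_less)
    have "X \<in> azukawa_indicatrix \<Omega> z \<longleftrightarrow> (\<exists>k m. X \<in> B m - N k m)" for X
    proof
      assume "X \<in> azukawa_indicatrix \<Omega> z"
      then obtain k where "\<forall>\<^sub>F \<zeta> in at 0. green \<Omega> z (z + \<zeta> *s X) - ereal (ln (norm \<zeta>)) \<le> - ereal (1 / real (Suc k))"
        unfolding azukawa_indicatrix_def mem_Collect_eq using Limsup_less_0E by blast
      then obtain \<delta> where \<delta>: "\<delta> > 0" "\<And>\<zeta>. \<zeta> \<noteq> 0 \<Longrightarrow> norm \<zeta> < \<delta> \<Longrightarrow>
          green \<Omega> z (z + \<zeta> *s X) - ereal (ln (norm \<zeta>)) \<le> - ereal (1 / real (Suc k))"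
        by (auto simp: eventually_at)
      obtain m :: nat where m: "max (1 / \<delta>) (norm X / r) < real m" using reals_Archimedean2 by blast
      have "1 / real (Suc m) < \<delta>" "norm X < r * real (Suc m)"
        using m \<delta>(1) r(1) by (auto simp: field_simps add_pos_pos intro: less_le_trans add_strict_increasing)
      then have "X \<in> B m - N k m" unfolding N using \<delta>(2) by (auto simp: B_def D_def)
      then show "\<exists>k m. X \<in> B m - N k m" by blast
    next
      assume "\<exists>k m. X \<in> B m - N k m"
      then obtain k m where km: "X \<in> B m - N k m" by blast
      have "\<forall>\<^sub>F \<zeta> in at 0. \<zeta> \<in> D m"
        unfolding D_def by (auto simp: eventually_at intro!: exI[of _ "1 / real (Suc m)"])
      then have "\<forall>\<^sub>F \<zeta> in at 0. green \<Omega> z (z + \<zeta> *s X) - ereal (ln (norm \<zeta>)) \<le> - ereal (1 / real (Suc k))"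
        using km[unfolded N] by (auto elim: eventually_mono)
      then have "Limsup (at 0) (\<lambda>\<zeta>. green \<Omega> z (z + \<zeta> *s X) - ereal (ln (norm \<zeta>))) \<le> - ereal (1 / real (Suc k))"
        by (rule Limsup_bounded)
      also have "\<dots> < 0" by (simp add: zero_ereal_def)
      finally show "X \<in> azukawa_indicatrix \<Omega> z" by (simp add: azukawa_indicatrix_def)
    qed
    then show ?thesis unfolding set_eq_iff UN_iff by simp
  qed
  show ?thesis unfolding eq by (intro sets.countable_UN image_subsetI sets.Diff Bm Nm)
qed

lemma azukawa_indicatrixI:
  assumes "c < 0" "\<forall>\<^sub>F \<zeta> in at 0. green \<Omega> z (z + \<zeta> *s X) \<le> ereal (ln (norm \<zeta>) + c)"
  shows "X \<in> azukawa_indicatrix \<Omega> z"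
proof -
  have "\<forall>\<^sub>F \<zeta> in at 0. green \<Omega> z (z + \<zeta> *s X) - ereal (ln (norm \<zeta>)) \<le> ereal c"
    using assms(2)
  proof eventually_elim
    case (elim \<zeta>)
    then show ?case by (cases "green \<Omega> z (z + \<zeta> *s X)") auto
  qed
  then have "Limsup (at 0) (\<lambda>\<zeta>. green \<Omega> z (z + \<zeta> *s X) - ereal (ln (norm \<zeta>))) \<le> ereal c"
    by (rule Limsup_bounded)
  also have "\<dots> < 0" using assms(1) by (simp add: zero_ereal_def)
  finally show ?thesis by (simp add: azukawa_indicatrix_def)
qed

text \<open>The zero vector is left out because it spans no line; a single point does not affect the
  volume.\<close>

lemma ball_subset_azukawa_indicatrix:
  assumes "ball z r \<subseteq> \<Omega>" "0 < r"
  shows "ball 0 r - {0} \<subseteq> azukawa_indicatrix \<Omega> z"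
proof
  fix X :: "complex^'a" assume "X \<in> ball 0 r - {0}"
  then have X: "X \<noteq> 0" "norm X < r" by auto
  show "X \<in> azukawa_indicatrix \<Omega> z"
  proof (rule azukawa_indicatrixI)
    have "0 < norm X / r" using X(1) assms(2) by simp
    then show "ln (norm X / r) < 0" using X(2) assms(2) by (intro ln_less_zero) (simp_all add: divide_less_eq)
    have "\<forall>\<^sub>F \<zeta> in at 0. \<zeta> \<noteq> (0::complex) \<and> norm \<zeta> < 1" by (auto simp: eventually_at intro!: exI[of _ 1])
    then show "\<forall>\<^sub>F \<zeta> in at 0. green \<Omega> z (z + \<zeta> *s X) \<le> ereal (ln (norm \<zeta>) + ln (norm X / r))"
    proof eventually_elim
      case (elim \<zeta>)
      have n: "norm (\<zeta> *s X) = norm \<zeta> * norm X" by (rule norm_vector_scalar_mult)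
      have "norm \<zeta> * norm X \<le> 1 * norm X" using elim by (intro mult_right_mono) auto
      then have "z + \<zeta> *s X \<in> ball z r" unfolding add_in_ball_iff n using X(2) by linarith
      moreover have "z + \<zeta> *s X \<noteq> z" using elim X by simp
      ultimately have "green \<Omega> z (z + \<zeta> *s X) \<le> ereal (ln (norm (z + \<zeta> *s X - z) / r))"
        by (intro green_le_ln assms)
      moreover have "ln (norm \<zeta> * norm X / r) = ln (norm \<zeta>) + ln (norm X / r)"
        using elim X(1) assms(2) by (simp add: ln_mult ln_div)
      ultimately show ?case by (simp add: n)
    qed
  qed
qed

section \<open>The gain from a point of the domain on the bounding sphere\<close>

lemma norm_cis_add_1_le: "norm (cis t + 1) \<le> \<bar>t - pi\<bar>"
proof -
  have "norm (cis t + 1) = norm (exp (\<i> * of_real t) - exp (\<i> * of_real pi))"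
    by (simp add: cis_conv_exp[symmetric])
  also have "\<dots> \<le> 1 * norm (of_real t - of_real pi :: complex)"
  proof (rule field_differentiable_bound[where S="range of_real" and f="\<lambda>x. exp (\<i> * x)" and f'="\<lambda>x. \<i> * exp (\<i> * x)"])
    show "convex (range complex_of_real)" by (simp add: convex_linear_image flip: scaleR_conv_of_real)
  qed (auto intro!: derivative_eq_intros simp: norm_mult)
  finally show ?thesis by (simp flip: of_real_diff)
qed

text \<open>The circle of radius \<rho> about \<zeta> stays in the slice of the domain although it
  may leave the unit disc. Its arc around the direction -1, of angle 1/2, lies in the disc of radius
  \<open>1 - \<rho> / 4\<close>, where u \<le> \<open>- \<rho> / 4\<close> by the logarithmic bound.
  Averaging, with u \<le> 0 on the rest of the circle, leaves \<open>\<rho> / 8\<close> divided by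
  \<open>2 * pi\<close>.\<close>

lemma green_family_bound_near_bulge:
  assumes u: "u \<in> green_family \<Omega> z" and X: "X \<noteq> 0" and \<rho>: "0 < \<rho>" "\<rho> \<le> 1/2"
    and disc: "\<And>\<zeta>. norm \<zeta> < 1 \<Longrightarrow> z + \<zeta> *s X \<in> \<Omega>"
    and bulge: "\<And>\<zeta>. norm (\<zeta> - 1) \<le> 2 * \<rho> \<Longrightarrow> z + \<zeta> *s X \<in> \<Omega>"
    and \<zeta>: "norm \<zeta> < 1" "norm (\<zeta> - 1) \<le> \<rho> / 2"
  shows "u (z + \<zeta> *s X) \<le> ereal (- \<rho> / (16 * pi))"
proof -
  have u': "u \<in> PSH_neg \<Omega>" using u by (simp add: green_family_def)
  let ?I = "{pi - 1/4..pi + 1/4}"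
  have sub: "?I \<subseteq> {0..2*pi}" using pi_gt3 by auto
  have key: "ennreal (\<rho> / 4) \<le> e2ennreal (- u (z + (\<zeta> + of_real \<rho> * cis t) *s X))" if "t \<in> ?I" for t
  proof -
    let ?y = "\<zeta> + of_real \<rho> * cis t"
    have c: "norm (cis t + 1) \<le> 1/4" using norm_cis_add_1_le[of t] that by auto
    have "norm ?y = norm ((\<zeta> - 1) + of_real (1 - \<rho>) + of_real \<rho> * (cis t + 1))" by (simp add: algebra_simps)
    also have "\<dots> \<le> \<rho> / 2 + (1 - \<rho>) + \<rho> * (1/4)"
      using \<zeta> \<rho> c by (intro norm_triangle_mono) (auto simp: norm_mult simp del: of_real_diff)
    finally have le: "norm ?y \<le> 1 - \<rho> / 4" by simp
    have "1 \<le> norm \<zeta> + \<rho> / 2" using \<zeta>(2) norm_triangle_ineq2[of 1 \<zeta>] by (simp add: norm_minus_commute)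
    moreover have "norm \<zeta> \<le> norm ?y + \<rho>"
      using norm_triangle_ineq4[of ?y "of_real \<rho> * cis t"] \<rho> by (simp add: norm_mult)
    ultimately have pos: "0 < norm ?y" using \<rho> by linarith
    have "u (z + ?y *s X) \<le> ereal (ln (norm ?y / 1))"
      using green_family_le_ln[OF u X zero_less_one disc pos] le \<rho> by simp
    also have "ln (norm ?y / 1) \<le> - (\<rho> / 4)"
      using ln_le_minus_one[OF pos] le by simp
    finally have "u (z + ?y *s X) \<le> ereal (- (\<rho> / 4))" by simp
    then have "ereal (\<rho> / 4) \<le> - u (z + ?y *s X)"
      by (cases "u (z + ?y *s X)") auto
    from e2ennreal_mono[OF this] show ?thesis by simp
  qed
  have "emeasure lborel ?I = ennreal (1/2)" by (subst emeasure_lborel_Icc) auto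
  then have "(\<integral>\<^sup>+t. ennreal (\<rho> / 4) * indicator ?I t \<partial>lborel) = ennreal (\<rho> / 4) * ennreal (1/2)"
    by (subst nn_integral_cmult_indicator) auto
  also have "\<dots> = ennreal (\<rho> / 8)" using \<rho> by (subst ennreal_mult[symmetric]) auto
  finally have "ennreal (\<rho> / 8) = (\<integral>\<^sup>+t. ennreal (\<rho> / 4) * indicator ?I t \<partial>lborel)" ..
  also have "\<dots> \<le> (\<integral>\<^sup>+t\<in>{0..2*pi}. e2ennreal (- u (z + (\<zeta> + of_real \<rho> * cis t) *s X)) \<partial>lborel)"
  proof (rule nn_integral_mono)
    fix t
    show "ennreal (\<rho> / 4) * indicator ?I t
        \<le> e2ennreal (- u (z + (\<zeta> + of_real \<rho> * cis t) *s X)) * indicator {0..2*pi} t"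
    proof (cases "t \<in> ?I")
      case True
      moreover from True have "t \<in> {0..2*pi}" using sub by blast
      ultimately show ?thesis using key[OF True] by simp
    qed simp
  qed
  also have "\<dots> \<le> e2ennreal (ereal (2 * pi) * - u (z + \<zeta> *s X))"
  proof (rule green_family_slice_super[OF u' _ \<rho>(1)])
    fix \<xi> assume "\<xi> \<in> cball \<zeta> \<rho>"
    then have "norm (\<xi> - \<zeta>) \<le> \<rho>" by (simp add: dist_norm norm_minus_commute)
    then have "norm (\<xi> - 1) \<le> 2 * \<rho>" using norm_triangle_ineq[of "\<xi> - \<zeta>" "\<zeta> - 1"] \<zeta>(2) \<rho> by simp
    then show "z + \<xi> *s X \<in> \<Omega>" by (rule bulge)
  qed
  finally have *: "ennreal (\<rho> / 8) \<le> e2ennreal (ereal (2 * pi) * - u (z + \<zeta> *s X))" .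
  have "u (z + \<zeta> *s X) < 0" using u' disc[OF \<zeta>(1)] by (auto simp: PSH_neg_def)
  then show ?thesis
  proof (cases "u (z + \<zeta> *s X)")
    case (real q)
    then have "ennreal (\<rho> / 8) \<le> ennreal (2 * pi * (- q))" "q < 0" using * \<open>u (z + \<zeta> *s X) < 0\<close> by auto
    then have "\<rho> / 8 \<le> 2 * pi * (- q)" by (subst (asm) ennreal_le_iff) (auto simp: mult_nonneg_nonpos less_imp_le)
    then show ?thesis using real by (simp add: field_simps)
  qed auto
qed

text \<open>The comparison function on the unit disc is a multiple of the Poisson kernel with pole \<open>S\<close>
  slightly outside: it is \<open>1\<close> at the origin and small on the circle away from \<open>1\<close>.\<close>

lemma Re_Poisson:
  fixes S :: real
  assumes "\<zeta> \<noteq> of_real S"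
  shows "Re ((of_real S + \<zeta>) / (of_real S - \<zeta>)) = (S\<^sup>2 - (norm \<zeta>)\<^sup>2) / (norm (of_real S - \<zeta>))\<^sup>2"
  unfolding Re_divide cmod_power2 by (simp add: power2_eq_square algebra_simps)

text \<open>\<open>K\<close> and \<open>d\<close> are chosen before the domain, the competitor and
  the direction: they depend on \<rho> alone. This uniformity allows both the supremum over
  \<open>u\<close> and an open set of directions.\<close>

lemma green_family_bulge_gain:
  assumes \<rho>: "0 < \<rho>" "\<rho> \<le> 1/2"
  obtains K d :: real where "K > 0" "d > 0"
    "\<And>(\<Omega>::(complex^'n) set) z u X \<zeta>. u \<in> green_family \<Omega> z \<Longrightarrow> X \<noteq> 0 \<Longrightarrow>
       (\<And>\<zeta>. norm \<zeta> < 1 \<Longrightarrow> z + \<zeta> *s X \<in> \<Omega>) \<Longrightarrow> (\<And>\<zeta>. norm (\<zeta> - 1) \<le> 2 * \<rho> \<Longrightarrow> z + \<zeta> *s X \<in> \<Omega>) \<Longrightarrow>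
       0 < norm \<zeta> \<Longrightarrow> norm \<zeta> < d \<Longrightarrow> u (z + \<zeta> *s X) \<le> ereal (ln (norm \<zeta>) - K)"
proof -
  \<comment> \<open>The bound \<open>\<rho> / 4\<close> keeps points farther than
    \<open>\<rho> / 2\<close> from 1 at distance at least \<open>\<rho> / 4\<close> from
    \<open>S\<close>; the bound \<open>\<rho>\<^sup>2 / 192\<close> then gives
    \<open>6 * \<kappa> \<le> (\<rho> / 4)\<^sup>2 / 2\<close>, so that the Poisson kernel is at
    most 1/2 at such points.\<close>
  define \<kappa> where "\<kappa> = min (\<rho> / 4) (\<rho>\<^sup>2 / 192)"
  have \<kappa>: "0 < \<kappa>" "\<kappa> \<le> \<rho> / 4" "\<kappa> \<le> \<rho>\<^sup>2 / 192" "\<kappa> < 1" using \<rho> by (auto simp: \<kappa>_def)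
  define S where "S = 1 + \<kappa>"
  define c0 where "c0 = \<rho> / (16 * pi)"
  \<comment> \<open>Near 1 the kernel is at most \<open>3 / \<kappa>\<close>, so this factor keeps
    \<open>Re (F \<xi>)\<close> above \<open>- c0\<close>, the bound that every competitor satisfies
    there.\<close>
  define c where "c = c0 * \<kappa> / 3"
  have c: "0 < c0" "0 < c" using \<rho> \<kappa> by (auto simp: c0_def c_def)
  \<comment> \<open>Subtracting 1/2 makes the real part nonnegative on the circle away from 1, where
    only u \<le> 0 is known, and still leaves \<open>- c / 2\<close> at the origin, where the kernel
    is 1.\<close>
  define F where "F \<zeta> = - of_real c * ((of_real S + \<zeta>) / (of_real S - \<zeta>) - 1/2)" for \<zeta> :: complex
  have nz: "\<zeta> \<noteq> of_real S" if "norm \<zeta> \<le> 1" for \<zeta> :: complex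
    using that \<kappa> by (auto simp: S_def simp del: of_real_add)
  have ReF: "Re (F \<zeta>) = - c * ((S\<^sup>2 - (norm \<zeta>)\<^sup>2) / (norm (of_real S - \<zeta>))\<^sup>2 - 1/2)" if "norm \<zeta> \<le> 1" for \<zeta>
    using Re_Poisson[OF nz[OF that]] by (simp add: F_def)
  have holF: "F holomorphic_on cball 0 1"
    unfolding F_def using nz by (intro holomorphic_intros) (simp, metis)
  then have contF: "continuous_on (cball 0 1) F" by (rule holomorphic_on_imp_continuous_on)
  have "(F \<longlongrightarrow> F 0) (at 0)"
    using continuous_on_interior[OF contF, of 0] by (simp add: isCont_def)
  then have "((\<lambda>\<zeta>. Re (F \<zeta>)) \<longlongrightarrow> Re (F 0)) (at 0)" by (rule tendsto_Re)
  moreover have "Re (F 0) = - c / 2" using nz[of 0] by (simp add: F_def)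
  then have "Re (F 0) < - c / 4" using c by simp
  ultimately have "\<forall>\<^sub>F \<zeta> in at 0. Re (F \<zeta>) < - c / 4" by (rule order_tendstoD)
  then obtain d where d: "d > 0" "\<And>\<zeta>. \<zeta> \<noteq> 0 \<Longrightarrow> norm \<zeta> < d \<Longrightarrow> Re (F \<zeta>) < - c / 4"
    by (auto simp: eventually_at)
  show thesis
  proof (rule that[of "c / 4" "min d 1"])
    show "0 < c / 4" "0 < min d 1" using c d by auto
    fix \<Omega> :: "(complex^'n) set" and z u X and \<zeta> :: complex
    assume u: "u \<in> green_family \<Omega> z" and X: "X \<noteq> 0"
      and disc: "\<And>\<zeta>. norm \<zeta> < 1 \<Longrightarrow> z + \<zeta> *s X \<in> \<Omega>"
      and bulge: "\<And>\<zeta>. norm (\<zeta> - 1) \<le> 2 * \<rho> \<Longrightarrow> z + \<zeta> *s X \<in> \<Omega>"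
      and \<zeta>: "0 < norm \<zeta>" "norm \<zeta> < min d 1"
    \<comment> \<open>Only the open unit disc is known to lie in the slice, hence r < 1; the
      condition r > \<open>1 - \<kappa>\<close> places \<open>S - r\<close> between
      \<open>\<kappa>\<close> and \<open>2 * \<kappa>\<close>.\<close>
    have step: "u (z + \<zeta> *s X) \<le> ereal (ln (norm \<zeta> / r) + Re (F \<zeta>))"
      if r: "1 - \<kappa> < r" "r < 1" "norm \<zeta> < r" for r
    proof (rule green_family_slice_le[OF u X])
      show "0 < r" using r \<kappa> by linarith
      show "z + \<xi> *s X \<in> \<Omega>" if "norm \<xi> \<le> r" for \<xi> using that r by (intro disc) simp
      show "continuous_on (cball 0 r) F" using r by (intro continuous_on_subset[OF contF]) auto
      show "F holomorphic_on ball 0 r" using r by (intro holomorphic_on_subset[OF holF]) auto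
      show "0 < norm \<zeta>" "norm \<zeta> \<le> r" using \<zeta> r by auto
      fix \<xi> :: complex assume \<xi>: "norm \<xi> = r"
      have rS: "r\<^sup>2 \<le> S\<^sup>2" using r \<kappa> by (intro power_mono) (auto simp: S_def)
      have fac: "S\<^sup>2 - r\<^sup>2 = (S + r) * (S - r)" by (simp add: power2_eq_square algebra_simps)
      have "norm (of_real S :: complex) = S" unfolding norm_of_real using \<kappa> by (simp add: S_def)
      then have dS: "S - r \<le> norm (of_real S - \<xi>)"
        using norm_triangle_ineq2[of "of_real S" \<xi>] \<xi> by simp
      have Sr: "0 < S - r" "\<kappa> \<le> S - r" "S + r \<le> 3" "S - r \<le> 2 * \<kappa>" "0 \<le> S + r" using r \<kappa> by (auto simp: S_def)
      show "u (z + \<xi> *s X) \<le> ereal (Re (F \<xi>))"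
      proof (cases "norm (\<xi> - 1) \<le> \<rho> / 2")
        case True
        have "(S\<^sup>2 - r\<^sup>2) / (norm (of_real S - \<xi>))\<^sup>2 \<le> (S\<^sup>2 - r\<^sup>2) / (S - r)\<^sup>2"
          using dS Sr rS by (intro divide_left_mono power_mono mult_pos_pos) auto
        also have "\<dots> = (S + r) / (S - r)" using Sr unfolding fac by (simp add: power2_eq_square)
        also have "\<dots> \<le> 3 / \<kappa>" using Sr \<kappa> by (intro frac_le) auto
        finally have "c * ((S\<^sup>2 - r\<^sup>2) / (norm (of_real S - \<xi>))\<^sup>2 - 1/2) \<le> c * (3 / \<kappa>)"
          using c by (intro mult_left_mono) auto
        also have "\<dots> = c0" using \<kappa> by (simp add: c_def)
        finally have "- c0 \<le> Re (F \<xi>)" using ReF[of \<xi>] \<xi> r by simp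
        moreover have "u (z + \<xi> *s X) \<le> ereal (- \<rho> / (16 * pi))"
          using \<xi> r by (intro green_family_bound_near_bulge[OF u X \<rho> disc bulge _ True]) auto
        ultimately show ?thesis unfolding c0_def by (metis ereal_less_eq(3) minus_divide_left order_trans)
      next
        case False
        have "norm (\<xi> - 1) \<le> norm (of_real S - \<xi>) + \<kappa>"
          using norm_triangle_ineq4[of "of_real S - \<xi>" "of_real \<kappa>"] \<kappa>
          by (simp add: S_def norm_minus_commute algebra_simps)
        then have "\<rho> / 4 \<le> norm (of_real S - \<xi>)" using False \<kappa> by linarith
        then have "(\<rho> / 4)\<^sup>2 \<le> (norm (of_real S - \<xi>))\<^sup>2" using \<rho> by (intro power_mono) auto
        moreover have "S\<^sup>2 - r\<^sup>2 \<le> 3 * (2 * \<kappa>)" unfolding fac using Sr by (intro mult_mono) auto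
        ultimately have "S\<^sup>2 - r\<^sup>2 \<le> (norm (of_real S - \<xi>))\<^sup>2 / 2"
          using \<kappa> by (simp add: power_divide)
        then have "(S\<^sup>2 - r\<^sup>2) / (norm (of_real S - \<xi>))\<^sup>2 \<le> 1/2"
          using nz[of \<xi>] \<xi> r by (subst pos_divide_le_eq) auto
        then have "c * ((S\<^sup>2 - r\<^sup>2) / (norm (of_real S - \<xi>))\<^sup>2 - 1/2) \<le> 0" using c by (simp add: mult_nonneg_nonpos)
        then have "0 \<le> Re (F \<xi>)" using ReF[of \<xi>] \<xi> r by simp
        moreover have "u (z + \<xi> *s X) \<le> 0"
          using u disc[of \<xi>] \<xi> r by (auto simp: green_family_def PSH_neg_def less_imp_le)
        ultimately show ?thesis by (metis ereal_less_eq(3) order_trans zero_ereal_def)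
      qed
    qed
    have "u (z + \<zeta> *s X) \<le> ereal (ln (norm \<zeta> / 1) + Re (F \<zeta>))"
    proof (rule tendsto_lowerbound)
      show "((\<lambda>r. ereal (ln (norm \<zeta> / r) + Re (F \<zeta>))) \<longlongrightarrow> ereal (ln (norm \<zeta> / 1) + Re (F \<zeta>))) (at_left 1)"
        using \<zeta> by (intro tendsto_intros) auto
      show "\<forall>\<^sub>F r in at_left 1. u (z + \<zeta> *s X) \<le> ereal (ln (norm \<zeta> / r) + Re (F \<zeta>))"
        using step \<zeta>(2) \<kappa> by (auto simp: eventually_at_left_field intro!: exI[of _ "max (1 - \<kappa>) (norm \<zeta>)"])
    qed simp
    also have "\<dots> \<le> ereal (ln (norm \<zeta>) - c / 4)" using d(2)[of \<zeta>] \<zeta> by simp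
    finally show "u (z + \<zeta> *s X) \<le> ereal (ln (norm \<zeta>) - c / 4)" .
  qed
qed

lemma azukawa_indicatrix_bulge:
  fixes z :: "complex^'n"
  assumes "open \<Omega>" "ball z \<delta> \<subseteq> \<Omega>" "0 < \<delta>" "p \<in> \<Omega>" "norm (p - z) = \<delta>"
  obtains W where "open W" "W \<noteq> {}" "W \<subseteq> azukawa_indicatrix \<Omega> z" "W \<inter> ball 0 \<delta> = {}"
proof -
  obtain e where e: "e > 0" "ball p e \<subseteq> \<Omega>" using assms by (auto simp: open_contains_ball)
  \<comment> \<open>A parameter within \<open>2 * \<rho>\<close> of 1 moves the point by at most
    \<open>2 * \<rho> * \<delta> \<le> e / 4\<close>; together with the \<open>e / 4\<close> allowed
    to the direction this stays in \<open>ball p e\<close>.\<close>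
  define \<rho> where "\<rho> = min (1/2) (e / (8 * \<delta>))"
  have \<rho>: "0 < \<rho>" "\<rho> \<le> 1/2" "2 * \<rho> * \<delta> \<le> e / 4"
    using e assms(3) by (auto simp: \<rho>_def min_def field_simps)
  obtain K d where K: "K > 0" "d > 0" and bd:
    "\<And>(\<Omega>::(complex^'n) set) z u X \<zeta>. u \<in> green_family \<Omega> z \<Longrightarrow> X \<noteq> 0 \<Longrightarrow>
       (\<And>\<zeta>. norm \<zeta> < 1 \<Longrightarrow> z + \<zeta> *s X \<in> \<Omega>) \<Longrightarrow> (\<And>\<zeta>. norm (\<zeta> - 1) \<le> 2 * \<rho> \<Longrightarrow> z + \<zeta> *s X \<in> \<Omega>) \<Longrightarrow>
       0 < norm \<zeta> \<Longrightarrow> norm \<zeta> < d \<Longrightarrow> u (z + \<zeta> *s X) \<le> ereal (ln (norm \<zeta>) - K)"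
    using green_family_bulge_gain[OF \<rho>(1,2)] by metis
  \<comment> \<open>Directions whose projection to the sphere of radius \<delta> is close to
    \<open>p - z\<close>, stretched by a factor s between 1 and \<open>exp K\<close>. Stretching
    costs \<open>ln s\<close>, which the gain \<open>K\<close> exceeds.\<close>
  define W where "W = {X \<in> - {0}. (norm X, norm ((\<delta> / norm X) *\<^sub>R X - (p - z))) \<in> {\<delta><..<\<delta> * exp K} \<times> {..<e/4}}"
  have "open W"
    unfolding W_def Collect_conj_eq Collect_mem_eq
    by (rule continuous_open_preimage[unfolded vimage_def]) (auto intro!: continuous_intros open_Times)
  moreover have "exp (K/2) *\<^sub>R (p - z) \<in> W"
    using assms(3,5) K e(1) by (auto simp: W_def)
  moreover have "W \<inter> ball 0 \<delta> = {}" by (auto simp: W_def)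
  moreover have "X \<in> azukawa_indicatrix \<Omega> z" if "X \<in> W" for X
  proof -
    have X: "X \<noteq> 0" "\<delta> < norm X" "norm X < \<delta> * exp K" "norm ((\<delta> / norm X) *\<^sub>R X - (p - z)) < e / 4"
      using that by (auto simp: W_def)
    define s where "s = norm X / \<delta>"
    define Y where "Y = (\<delta> / norm X) *\<^sub>R X"
    have s: "1 < s" "s < exp K"
      using X assms(3) by (auto simp: s_def divide_less_eq less_divide_eq mult.commute)
    then have "ln s < K" by (metis exp_ln exp_less_cancel_iff order.strict_trans zero_less_one)
    have Y: "norm Y = \<delta>" "Y \<noteq> 0" "norm (Y - (p - z)) < e / 4" using X assms(3) by (auto simp: Y_def)
    have XY: "\<zeta> *s X = (\<zeta> * of_real s) *s Y" for \<zeta>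
    proof -
      have "norm X \<noteq> 0" using X(1) by simp
      then have "\<zeta> * X $ i = \<zeta> * of_real s * Y $ i" for i
        using assms(3) by (simp add: Y_def s_def scaleR_conv_of_real[where 'a=complex])
      then show ?thesis by (simp add: vec_eq_iff)
    qed
    have disc: "z + \<zeta> *s Y \<in> \<Omega>" if "norm \<zeta> < 1" for \<zeta>
    proof -
      have "norm (\<zeta> *s Y) < \<delta>" unfolding norm_vector_scalar_mult using that Y assms(3) by simp
      then have "z + \<zeta> *s Y \<in> ball z \<delta>" unfolding add_in_ball_iff .
      then show ?thesis using assms(2) by blast
    qed
    have bulge: "z + \<zeta> *s Y \<in> \<Omega>" if "norm (\<zeta> - 1) \<le> 2 * \<rho>" for \<zeta>
    proof -
      have "z + \<zeta> *s Y = p + ((\<zeta> - 1) *s Y + (Y - (p - z)))" by (simp add: vec_eq_iff algebra_simps)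
      moreover have "norm ((\<zeta> - 1) *s Y) \<le> e / 4"
        unfolding norm_vector_scalar_mult using order_trans[OF mult_right_mono[OF that] \<rho>(3)] Y(1) assms(3) by simp
      then have "norm ((\<zeta> - 1) *s Y + (Y - (p - z))) < e"
        using norm_triangle_ineq[of "(\<zeta> - 1) *s Y" "Y - (p - z)"] Y(3) e(1) by linarith
      ultimately have "z + \<zeta> *s Y \<in> ball p e" by (simp only: add_in_ball_iff)
      then show ?thesis using e by blast
    qed
    show ?thesis
    proof (rule azukawa_indicatrixI)
      show "ln s - K < 0" using \<open>ln s < K\<close> by simp
      have "\<forall>\<^sub>F \<zeta> in at 0. \<zeta> \<noteq> (0::complex) \<and> norm \<zeta> < d / s"
        using K s by (auto simp: eventually_at intro!: exI[of _ "d / s"])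
      then show "\<forall>\<^sub>F \<zeta> in at 0. green \<Omega> z (z + \<zeta> *s X) \<le> ereal (ln (norm \<zeta>) + (ln s - K))"
      proof eventually_elim
        case (elim \<zeta>)
        have n: "norm (\<zeta> * of_real s) = norm \<zeta> * s" using s by (simp add: norm_mult)
        have "0 < norm (\<zeta> * of_real s)" "norm (\<zeta> * of_real s) < d"
          using elim s unfolding n by (auto simp: field_simps)
        from bd[OF _ Y(2) disc bulge this]
        have "green \<Omega> z (z + \<zeta> *s X) \<le> ereal (ln (norm (\<zeta> * of_real s)) - K)"
          unfolding green_eq_SUP XY by (intro SUP_least)
        also have "ln (norm (\<zeta> * of_real s)) - K = ln (norm \<zeta>) + (ln s - K)"
          using elim s unfolding n by (simp add: ln_mult)
        finally show ?case .
      qed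
    qed
  qed
  ultimately show thesis by (intro that[of W]) auto
qed

section \<open>The Green function of a ball\<close>

definition neg_log :: "real \<Rightarrow> complex \<Rightarrow> ereal" where
  "neg_log R w = (if w = 0 then \<infinity> else ereal (ln R - ln (norm w)))"

lemma less_neg_log_iff:
  assumes "0 < R"
  shows "ereal c < neg_log R w \<longleftrightarrow> norm w < R * exp (- c)"
proof (cases "w = 0")
  case False
  then have "c < ln R - ln (norm w) \<longleftrightarrow> ln (norm w) < ln (R * exp (- c))"
    using assms by (simp add: ln_mult) linarith
  then show ?thesis using False assms by (simp add: neg_log_def)
qed (use assms in \<open>simp add: neg_log_def\<close>)

lemma lsc_neg_log:
  assumes "0 < R"
  shows "lsc_on UNIV (neg_log R)"
  unfolding lsc_on_UNIV_iff
proof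
  fix c show "open {w. c < neg_log R w}"
  proof (cases c)
    case (real q)
    then have "{w. c < neg_log R w} = ball 0 (R * exp (- q))"
      by (simp add: less_neg_log_iff[OF assms] ball_def)
    then show ?thesis by simp
  next
    case MInf
    then have "{w. c < neg_log R w} = UNIV" by (auto simp: neg_log_def)
    then show ?thesis by simp
  qed auto
qed

lemma nn_integral_neg_log_circle:
  assumes "0 < R" "\<And>t. norm (a + b * cis t) < R" "norm b < norm a"
  shows "(\<integral>\<^sup>+t\<in>{0..2*pi}. e2ennreal (neg_log R (a + b * cis t)) \<partial>lborel) = ennreal (2 * pi * (ln R - ln (norm a)))"
proof -
  have nz: "a + b * cis t \<noteq> 0" for t
  proof
    assume "a + b * cis t = 0"
    then have "norm a = norm (b * cis t)" by (metis add_eq_0_iff norm_minus_cancel)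
    with assms(3) show False by (simp add: norm_mult)
  qed
  have "((\<lambda>t. ln R - ln (norm (a + b * cis t))) has_integral (2 * pi * ln R - 2 * pi * ln (norm a))) {0..2*pi}"
    using has_integral_const_real[of "ln R" 0 "2*pi"]
    by (intro has_integral_diff has_integral_circle_ln_norm[OF assms(3)]) (auto simp: mult.commute)
  moreover have "0 \<le> ln R - ln (norm (a + b * cis t))" for t
    using assms(1) assms(2)[of t] nz[of t] by simp
  ultimately have "(\<integral>\<^sup>+t\<in>{0..2*pi}. ennreal (ln R - ln (norm (a + b * cis t))) \<partial>lborel) =
      ennreal (2 * pi * ln R - 2 * pi * ln (norm a))"
    by (intro nn_integral_Icc_eq)
  then show ?thesis using nz by (simp add: neg_log_def right_diff_distrib)
qed

text \<open>The cases are the positions of the zero of a + b \<zeta>. Outside the closed unit disc,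
  the mean is the value at \<open>a\<close>. Inside, conjugation on the circle exchanges
  \<open>a\<close> and \<open>b\<close>, and the mean is the smaller value at \<open>cnj b\<close>.
  On the circle, \<open>b\<close> is shrunk by factors \<open>s n < 1\<close>, which returns to the
  first case, and Fatou's lemma gives the limit.\<close>

lemma neg_log_circle_mean:
  assumes R: "0 < R" and disc: "\<And>\<zeta>. norm \<zeta> \<le> 1 \<Longrightarrow> norm (a + b * \<zeta>) < R"
  shows "(\<integral>\<^sup>+t\<in>{0..2*pi}. e2ennreal (neg_log R (a + b * cis t)) \<partial>lborel) \<le> e2ennreal (ereal (2 * pi) * neg_log R a)"
proof (cases "a = 0")
  case False
  have circ: "norm (a + b * cis t) < R" for t by (intro disc) simp
  have rhs: "e2ennreal (ereal (2 * pi) * neg_log R a) = ennreal (2 * pi * (ln R - ln (norm a)))"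
    using False by (simp add: neg_log_def)
  consider "norm b < norm a" | "norm a < norm b" | "norm b = norm a" by linarith
  then show ?thesis
  proof cases
    case 1
    show ?thesis unfolding rhs nn_integral_neg_log_circle[OF R circ 1] ..
  next
    case 2
    have sw: "norm (a + b * cis t) = norm (cnj b + cnj a * cis t)" for t
    proof -
      have "cnj (a + b * cis t) * cis t = cnj b + cnj a * cis t"
        by (simp add: algebra_simps cis_cnj cis_mult)
      then show ?thesis by (metis complex_mod_cnj mult.right_neutral norm_cis norm_mult)
    qed
    then have nl: "neg_log R (a + b * cis t) = neg_log R (cnj b + cnj a * cis t)" for t
      unfolding neg_log_def by (metis norm_eq_zero)
    have "(\<integral>\<^sup>+t\<in>{0..2*pi}. e2ennreal (neg_log R (a + b * cis t)) \<partial>lborel) = ennreal (2 * pi * (ln R - ln (norm (cnj b))))"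
      unfolding nl using circ 2 unfolding sw by (intro nn_integral_neg_log_circle[OF R]) simp_all
    also have "\<dots> \<le> ennreal (2 * pi * (ln R - ln (norm a)))"
      using 2 False by (intro ennreal_leI mult_left_mono diff_left_mono ln_mono) auto
    finally show ?thesis unfolding rhs .
  next
    case 3
    define s where "s n = 1 - inverse (real (Suc n))" for n
    have s: "0 \<le> s n" "s n < 1" for n by (auto simp: s_def inverse_le_1_iff)
    have slim: "s \<longlonglongrightarrow> 1" unfolding s_def
      using tendsto_diff[OF tendsto_const LIMSEQ_inverse_real_of_nat, of "1::real"] by simp
    have lsc: "lsc_on UNIV (\<lambda>w. e2ennreal (neg_log R w))" by (intro lsc_on_UNIV_e2ennreal lsc_neg_log R)
    have meas: "(\<lambda>t. e2ennreal (neg_log R (a + (s n * b) * cis t))) \<in> borel_measurable borel" for n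
    proof (rule borel_measurable_lsc)
      show "lsc_on UNIV (\<lambda>t. e2ennreal (neg_log R (a + (s n * b) * cis t)))"
        by (rule lsc_on_compose[OF lsc]) (auto intro!: continuous_intros)
    qed
    have "(\<lambda>n. a + (s n * b) * cis t) \<longlonglongrightarrow> a + (of_real 1 * b) * cis t" for t
      by (intro tendsto_intros slim)
    then have "(\<integral>\<^sup>+t\<in>{0..2*pi}. e2ennreal (neg_log R (a + b * cis t)) \<partial>lborel)
      \<le> (\<integral>\<^sup>+t\<in>{0..2*pi}. liminf (\<lambda>n. e2ennreal (neg_log R (a + (s n * b) * cis t))) \<partial>lborel)"
      by (intro nn_integral_mono mult_right_mono lsc_on_UNIV_le_liminf[OF lsc]) auto
    also have "\<dots> = (\<integral>\<^sup>+t. liminf (\<lambda>n. e2ennreal (neg_log R (a + (s n * b) * cis t)) * indicator {0..2*pi} t) \<partial>lborel)"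
      by (intro nn_integral_cong) (auto simp: indicator_def Liminf_const)
    also have "\<dots> \<le> liminf (\<lambda>n. (\<integral>\<^sup>+t\<in>{0..2*pi}. e2ennreal (neg_log R (a + (s n * b) * cis t)) \<partial>lborel))"
      using meas by (intro nn_integral_liminf borel_measurable_times) auto
    also have "(\<lambda>n. (\<integral>\<^sup>+t\<in>{0..2*pi}. e2ennreal (neg_log R (a + (s n * b) * cis t)) \<partial>lborel)) =
        (\<lambda>n. ennreal (2 * pi * (ln R - ln (norm a))))"
    proof
      fix n
      have "norm (a + (s n * b) * cis t) < R" for t
        using disc[of "s n * cis t"] s[of n] by (simp add: norm_mult mult_ac)
      moreover have "norm (s n * b) < norm a" using 3 s[of n] False by (simp add: norm_mult)
      ultimately show "(\<integral>\<^sup>+t\<in>{0..2*pi}. e2ennreal (neg_log R (a + (s n * b) * cis t)) \<partial>lborel) =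
        ennreal (2 * pi * (ln R - ln (norm a)))"
        by (intro nn_integral_neg_log_circle R)
    qed
    finally show ?thesis unfolding rhs by (simp add: Liminf_const)
  qed
qed (simp add: neg_log_def)

lemma norm_sum_mult_cnj_le: "norm (\<Sum>i\<in>UNIV. v $ i * cnj (X $ i)) \<le> norm v * norm (X::complex^'n)"
proof -
  have "norm (\<Sum>i\<in>UNIV. v $ i * cnj (X $ i)) \<le> (\<Sum>i\<in>UNIV. \<bar>norm (v $ i)\<bar> * \<bar>norm (X $ i)\<bar>)"
    by (rule order_trans[OF norm_sum]) (simp add: norm_mult)
  also have "\<dots> \<le> norm v * norm X" unfolding norm_vec_def by (rule L2_set_mult_ineq)
  finally show ?thesis .
qed

lemma sum_mult_cnj_self: "(\<Sum>i\<in>UNIV. X $ i * cnj (X $ i)) = of_real ((norm (X::complex^'n))\<^sup>2)"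
  unfolding complex_norm_square[symmetric] of_real_sum[symmetric]
  by (simp add: norm_vec_def L2_set_def sum_nonneg del: of_real_sum of_real_power)

text \<open>On a ball, the logarithm of the modulus of the complex linear form dual to \<open>X\<close> competes in the Green
  function and is extremal on the line through \<open>X\<close>.\<close>

lemma green_ball_ge:
  fixes z X :: "complex^'n"
  assumes "0 < r" "X \<noteq> 0" "w \<in> ball z r"
  shows "- neg_log (r * norm X) (\<Sum>i\<in>UNIV. (w - z) $ i * cnj (X $ i)) \<le> green (ball z r) z w"
proof -
  define l where "l v = (\<Sum>i\<in>UNIV. v $ i * cnj (X $ i))" for v
  define R where "R = r * norm X"
  have R: "0 < R" using assms by (simp add: R_def)
  define u where "u w = - neg_log R (l (w - z))" for w
  have l: "norm (l (w - z)) < R" if "w \<in> ball z r" for w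
  proof -
    have "norm (l (w - z)) \<le> norm (w - z) * norm X" unfolding l_def by (rule norm_sum_mult_cnj_le)
    also have "\<dots> < r * norm X" using that assms(2) by (intro mult_strict_right_mono) (auto simp: dist_norm norm_minus_commute)
    finally show ?thesis by (simp add: R_def)
  qed
  have neg: "u w < 0" if "w \<in> ball z r" for w
    using less_neg_log_iff[OF R, of 0 "l (w - z)"] l[OF that]
    by (cases "neg_log R (l (w - z))") (auto simp: u_def)
  have lin: "l (a + \<zeta> *s b - z) = l (a - z) + l b * \<zeta>" for a b \<zeta>
  proof -
    have "(a + \<zeta> *s b - z) $ i * cnj (X $ i) = (a - z) $ i * cnj (X $ i) + b $ i * cnj (X $ i) * \<zeta>" for i
      by (simp add: algebra_simps)
    then show ?thesis unfolding l_def by (simp only: sum.distrib sum_distrib_right)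
  qed
  have cl: "continuous_on S (\<lambda>w. l (w - z))" for S unfolding l_def by (intro continuous_intros)
  have "psh_on u (ball z r)"
  proof (subst psh_on_nonpos_iff, goal_cases)
    case (1 w) then show ?case using neg less_imp_le by blast
  next
    case 2
    show ?case
    proof (intro conjI allI impI)
      show "lsc_on (ball z r) (\<lambda>w. - u w)"
        unfolding u_def ereal_uminus_uminus by (rule lsc_on_compose[OF lsc_neg_log[OF R] cl]) simp
      fix a b assume disc: "\<forall>\<zeta>. norm \<zeta> \<le> 1 \<longrightarrow> a + \<zeta> *s b \<in> ball z r"
      have "(\<integral>\<^sup>+t\<in>{0..2*pi}. e2ennreal (neg_log R (l (a - z) + l b * cis t)) \<partial>lborel)
          \<le> e2ennreal (ereal (2 * pi) * neg_log R (l (a - z)))"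
      proof (rule neg_log_circle_mean[OF R])
        fix \<zeta> :: complex assume "norm \<zeta> \<le> 1"
        with disc l show "norm (l (a - z) + l b * \<zeta>) < R" unfolding lin[symmetric] by blast
      qed
      then show "(\<integral>\<^sup>+t\<in>{0..2*pi}. e2ennreal (- u (a + cis t *s b)) \<partial>lborel) \<le> e2ennreal (ereal (2 * pi) * - u a)"
        unfolding u_def ereal_uminus_uminus lin .
    qed
  qed
  then have "u \<in> PSH_neg (ball z r)" using neg by (auto simp: PSH_neg_def)
  then have "u \<in> green_family (ball z r) z"
  proof (rule green_familyI)
    have "\<forall>\<^sub>F x in at z within ball z r. x \<noteq> z" by (auto simp: eventually_at intro!: exI[of _ 1])
    then show "\<forall>\<^sub>F x in at z within ball z r. u x \<le> ereal (ln (norm (x - z)) + - ln r)"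
    proof eventually_elim
      case (elim x)
      show ?case
      proof (cases "l (x - z) = 0")
        case False
        have "norm (l (x - z)) \<le> norm (x - z) * norm X" unfolding l_def by (rule norm_sum_mult_cnj_le)
        then have "ln (norm (l (x - z))) \<le> ln (norm (x - z) * norm X)" using False by (intro ln_mono) auto
        also have "\<dots> = ln (norm (x - z)) + ln (norm X)" using elim assms(2) by (simp add: ln_mult)
        finally show ?thesis using False assms by (simp add: u_def neg_log_def R_def ln_mult)
      qed (simp add: u_def neg_log_def)
    qed
  qed
  then have "u w \<le> green (ball z r) z w" unfolding green_eq_SUP by (rule SUP_upper)
  then show ?thesis by (simp add: u_def l_def R_def)
qed

text \<open>At \<open>z + \<zeta> *s X\<close> the form dual to \<open>X\<close> takes the value
  \<zeta> times \<open>(norm X)\<^sup>2\<close>, so with \<open>R = r * norm X\<close> the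
  competitor equals \<open>ln (norm \<zeta>) + ln (norm X / r)\<close>. The limit superior is thus
  at least \<open>ln (norm X / r)\<close>.\<close>

lemma azukawa_indicatrix_ball_subset:
  fixes z :: "complex^'n"
  assumes "0 < r"
  shows "azukawa_indicatrix (ball z r) z \<subseteq> ball 0 r"
proof
  fix X assume X: "X \<in> azukawa_indicatrix (ball z r) z"
  show "X \<in> ball 0 r"
  proof (cases "X = 0")
    case False
    have "\<forall>\<^sub>F \<zeta> in at 0. \<zeta> \<noteq> (0::complex) \<and> norm \<zeta> < r / norm X"
      using False assms by (auto simp: eventually_at intro!: exI[of _ "r / norm X"])
    then have "\<forall>\<^sub>F \<zeta> in at 0. ereal (ln (norm X / r)) \<le> green (ball z r) z (z + \<zeta> *s X) - ereal (ln (norm \<zeta>))"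
    proof eventually_elim
      case (elim \<zeta>)
      then have "norm (\<zeta> *s X) < r" using False by (simp add: norm_vector_scalar_mult pos_less_divide_eq)
      then have "z + \<zeta> *s X \<in> ball z r" unfolding add_in_ball_iff .
      then have "- neg_log (r * norm X) (\<Sum>i\<in>UNIV. (z + \<zeta> *s X - z) $ i * cnj (X $ i)) \<le> green (ball z r) z (z + \<zeta> *s X)"
        by (intro green_ball_ge assms False)
      also have "(\<Sum>i\<in>UNIV. (z + \<zeta> *s X - z) $ i * cnj (X $ i)) = \<zeta> * of_real ((norm X)\<^sup>2)"
        unfolding sum_mult_cnj_self[symmetric] by (simp add: sum_distrib_left mult.assoc)
      also have "- neg_log (r * norm X) (\<zeta> * of_real ((norm X)\<^sup>2)) = ereal (ln (norm \<zeta>) + ln (norm X / r))"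
        using elim False assms by (simp add: neg_log_def norm_mult norm_power ln_mult ln_div power2_eq_square)
      finally show ?case by (cases "green (ball z r) z (z + \<zeta> *s X)") auto
    qed
    then have "Limsup (at 0) (\<lambda>\<zeta>::complex. ereal (ln (norm X / r)))
        \<le> Limsup (at 0) (\<lambda>\<zeta>. green (ball z r) z (z + \<zeta> *s X) - ereal (ln (norm \<zeta>)))"
      by (rule Limsup_mono)
    also have "\<dots> < 0" using X by (simp add: azukawa_indicatrix_def)
    finally have "ln (norm X / r) < 0" by (simp add: Limsup_const zero_ereal_def)
    moreover have "0 < norm X / r" using False assms by simp
    ultimately have "norm X / r < 1" by (simp only: ln_less_zero_iff)
    then show ?thesis using assms by simp
  qed (use assms in simp)
qed

section \<open>Mean values over balls\<close>

lemma emeasure_ball_less_top: "emeasure lborel (ball (c::'a::euclidean_space) r) < top"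
  using emeasure_lborel_ball_finite[of c r] by simp

lemma integrable_indicator_ball [simp]: "integrable lborel (indicator (ball (c::'a::euclidean_space) r) :: 'a \<Rightarrow> real)"
  by (intro integrable_real_indicator) (auto simp: emeasure_ball_less_top)

text \<open>Comparing the two orders of integration of \<open>\<integral>\<integral> 1\<^sub>A(y + T x) 1\<^sub>B(T x) dx dy\<close> for the unit ball \<open>B\<close> shows
  that \<open>T\<close> preserves volume; this avoids determinants.\<close>

lemma lborel_distr_linear_isometry:
  fixes T :: "'a::euclidean_space \<Rightarrow> 'a"
  assumes "linear T" and iso: "\<And>x. norm (T x) = norm x"
  shows "distr lborel borel T = lborel"
proof (rule measure_eqI)
  fix A assume "A \<in> sets (distr lborel borel T)"
  then have A[measurable]: "A \<in> sets borel" by simp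
  have "continuous_on UNIV T" using \<open>linear T\<close> by (simp add: linear_continuous_on linear_conv_bounded_linear)
  then have T[measurable]: "T \<in> borel_measurable borel" by (rule borel_measurable_continuous_onI)
  have "inj T" using \<open>linear T\<close> iso by (metis linear_injective_0 norm_eq_zero)
  then have "surj T" using \<open>linear T\<close> by (simp add: linear_injective_imp_surjective)
  define B where "B = ball (0::'a) 1"
  have B[measurable]: "B \<in> sets borel" by (simp add: B_def)
  have shift: "(\<integral>\<^sup>+x. f (x + c) \<partial>lborel) = (\<integral>\<^sup>+x. f x \<partial>lborel)"
    if [measurable]: "f \<in> borel_measurable borel" for f :: "'a \<Rightarrow> ennreal" and c
  proof -
    have "(\<integral>\<^sup>+x. f x \<partial>lborel) = (\<integral>\<^sup>+x. f x \<partial>distr lborel borel ((+) c))" by (simp add: lborel_distr_plus)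
    also have "\<dots> = (\<integral>\<^sup>+x. f (c + x) \<partial>lborel)" by (subst nn_integral_distr) auto
    finally show ?thesis by (simp add: add.commute)
  qed
  have "(\<integral>\<^sup>+x. (\<integral>\<^sup>+y. indicator A (y + T x) * indicator B (T x) \<partial>lborel) \<partial>lborel) =
      (\<integral>\<^sup>+x. emeasure lborel A * indicator B x \<partial>lborel)"
  proof (rule nn_integral_cong)
    fix x
    have "(\<integral>\<^sup>+y. indicator A (y + T x) * indicator B (T x) \<partial>lborel) =
       (\<integral>\<^sup>+y. indicator A (y + T x) \<partial>lborel) * indicator B (T x)"
      by (rule nn_integral_multc) measurable
    also have "(\<integral>\<^sup>+y. indicator A (y + T x) \<partial>lborel) = emeasure lborel A"
      using shift[of "indicator A" "T x"] by simp
    also have "emeasure lborel A * indicator B (T x) = emeasure lborel A * indicator B x" by (simp add: B_def indicator_def iso)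
    finally show "(\<integral>\<^sup>+y. indicator A (y + T x) * indicator B (T x) \<partial>lborel) = emeasure lborel A * indicator B x" .
  qed
  also have "\<dots> = emeasure lborel A * emeasure lborel B" by (rule nn_integral_cmult_indicator) simp
  finally have 1: "(\<integral>\<^sup>+x. (\<integral>\<^sup>+y. indicator A (y + T x) * indicator B (T x) \<partial>lborel) \<partial>lborel) =
      emeasure lborel A * emeasure lborel B" .
  have "(\<integral>\<^sup>+x. (\<integral>\<^sup>+y. indicator A (y + T x) * indicator B (T x) \<partial>lborel) \<partial>lborel) =
     (\<integral>\<^sup>+y. (\<integral>\<^sup>+x. indicator A (y + T x) * indicator B (T x) \<partial>lborel) \<partial>lborel)"
    by (rule lborel_pair.Fubini') measurable
  also have "\<dots> = (\<integral>\<^sup>+y. (\<integral>\<^sup>+x. indicator A (T x) * indicator B (T x - y) \<partial>lborel) \<partial>lborel)"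
  proof (rule nn_integral_cong)
    fix y
    \<comment> \<open>Writing \<open>y\<close> as \<open>T c\<close> lets a translation in
      \<open>x\<close> move \<open>y\<close> from the factor of \<open>A\<close> to the factor of
      \<open>B\<close>, where integration over \<open>y\<close> gives the volume of a unit
      ball.\<close>
    obtain c where c: "y = T c" using \<open>surj T\<close> by (metis surjD)
    have "(\<integral>\<^sup>+x. indicator A (T x) * indicator B (T x - y) \<partial>lborel) =
      (\<integral>\<^sup>+x. indicator A (T (x + c)) * indicator B (T (x + c) - y) \<partial>lborel)"
      by (rule shift[symmetric]) measurable
    then show "(\<integral>\<^sup>+x. indicator A (y + T x) * indicator B (T x) \<partial>lborel) =
      (\<integral>\<^sup>+x. indicator A (T x) * indicator B (T x - y) \<partial>lborel)"
      by (simp add: linear_add[OF \<open>linear T\<close>] c add.commute)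
  qed
  also have "\<dots> = (\<integral>\<^sup>+x. (\<integral>\<^sup>+y. indicator A (T x) * indicator B (T x - y) \<partial>lborel) \<partial>lborel)"
    by (rule lborel_pair.Fubini') measurable
  also have "\<dots> = (\<integral>\<^sup>+x. indicator A (T x) * emeasure lborel B \<partial>lborel)"
  proof (rule nn_integral_cong)
    fix x
    have "indicator B (T x - y) = (indicator (ball (T x) 1) y :: ennreal)" for y
      by (simp add: B_def indicator_def dist_norm norm_minus_commute)
    then have "(\<integral>\<^sup>+y. indicator A (T x) * indicator B (T x - y) \<partial>lborel) =
       indicator A (T x) * (\<integral>\<^sup>+y. indicator (ball (T x) 1) y \<partial>lborel)"
      by (simp only:) (rule nn_integral_cmult, rule borel_measurable_indicator, simp)
    also have "(\<integral>\<^sup>+y. indicator (ball (T x) 1) y \<partial>lborel) = emeasure lborel B"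
      by (simp add: B_def emeasure_ball)
    finally show "(\<integral>\<^sup>+y. indicator A (T x) * indicator B (T x - y) \<partial>lborel) = indicator A (T x) * emeasure lborel B" .
  qed
  also have "\<dots> = (\<integral>\<^sup>+x. indicator A (T x) \<partial>lborel) * emeasure lborel B"
    by (rule nn_integral_multc) measurable
  also have "(\<integral>\<^sup>+x. indicator A (T x) \<partial>lborel) = (\<integral>\<^sup>+x. indicator A x \<partial>distr lborel borel T)"
    by (subst nn_integral_distr) auto
  also have "\<dots> = emeasure (distr lborel borel T) A" by simp
  finally have "emeasure (distr lborel borel T) A * emeasure lborel B = emeasure lborel A * emeasure lborel B"
    using 1 by simp
  moreover have "emeasure lborel B \<noteq> 0" "emeasure lborel B \<noteq> top"
    by (auto simp: B_def emeasure_ball unit_ball_vol_pos ennreal_eq_0_iff not_le)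
  ultimately show "emeasure (distr lborel borel T) A = emeasure lborel A"
    by (simp add: ennreal_mult_cancel_left mult.commute[of _ "emeasure lborel B"])
qed simp

lemma holomorphic_Cn_on_slice:
  assumes "holomorphic_Cn_on f \<Omega>" "open \<Omega>"
  shows "(\<lambda>\<zeta>. f (q + \<zeta> *s w)) holomorphic_on {\<zeta>. q + \<zeta> *s w \<in> \<Omega>}"
proof (rule holomorphic_onI)
  fix \<zeta> assume "\<zeta> \<in> {\<zeta>. q + \<zeta> *s w \<in> \<Omega>}"
  then obtain D where D: "(f has_derivative D) (at (q + \<zeta> *s w))" "\<And>c v. D (c *s v) = c * D v"
    using assms by (auto simp: holomorphic_Cn_on_def)
  have "((\<lambda>\<zeta>. q + \<zeta> *s w) has_derivative (\<lambda>c. c *s w)) (at \<zeta>)"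
    using bounded_linear_imp_has_derivative[OF bounded_linear_scalar_mult_left] by (auto intro!: derivative_eq_intros)
  from has_derivative_compose[OF this D(1)] have "((\<lambda>\<zeta>. f (q + \<zeta> *s w)) has_field_derivative D w) (at \<zeta>)"
    unfolding has_field_derivative_def D(2) mult.commute[of _ "D w"] .
  then show "(\<lambda>\<zeta>. f (q + \<zeta> *s w)) field_differentiable at \<zeta> within {\<zeta>. q + \<zeta> *s w \<in> \<Omega>}"
    using field_differentiable_at_within field_differentiable_def by blast
qed

lemma holomorphic_Cn_on_imp_continuous_on:
  assumes "holomorphic_Cn_on f \<Omega>"
  shows "continuous_on \<Omega> f"
  using assms unfolding holomorphic_Cn_on_def
  by (intro continuous_at_imp_continuous_on) (metis has_derivative_continuous)

text \<open>The average of \<open>f\<close> over the ball is the average over the rotations \<open>w \<mapsto> e\<^sup>i\<^sup>t w\<close> of the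
  circle means of the slices, each of which is the value at the centre.\<close>

lemma integral_ball_holomorphic:
  fixes f :: "complex^'n \<Rightarrow> complex"
  assumes f: "holomorphic_Cn_on f (ball q \<rho>)" and int: "set_integrable lborel (ball q \<rho>) f"
  shows "(LINT w:ball q \<rho>|lborel. f w) = measure lborel (ball q \<rho>) *\<^sub>R f q"
proof -
  define h where "h w = indicator (ball 0 \<rho>) w *\<^sub>R f (q + w)" for w
  have "continuous_on (ball q \<rho>) f" by (rule holomorphic_Cn_on_imp_continuous_on[OF f])
  have hq: "h = (\<lambda>w. indicator (ball q \<rho>) (q + w) *\<^sub>R f (q + w))"
    by (auto simp: h_def indicator_def dist_norm)
  have m: "(\<lambda>w. indicator (ball q \<rho>) w *\<^sub>R f w) \<in> borel_measurable borel"
    using borel_measurable_integrable[OF int[unfolded set_integrable_def]] by simp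
  then have [measurable]: "h \<in> borel_measurable borel"
    unfolding hq by (rule measurable_compose[rotated]) simp
  have inth: "integrable lborel h"
  proof -
    have "integrable (distr lborel borel ((+) q)) (\<lambda>w. indicator (ball q \<rho>) w *\<^sub>R f w)"
      using int by (simp add: set_integrable_def lborel_distr_plus)
    then show ?thesis unfolding hq by (subst (asm) integrable_distr_eq) (use m in auto)
  qed
  have Ih: "integral\<^sup>L lborel h = (LINT w:ball q \<rho>|lborel. f w)"
  proof -
    have "(LINT w:ball q \<rho>|lborel. f w) = integral\<^sup>L (distr lborel borel ((+) q)) (\<lambda>w. indicator (ball q \<rho>) w *\<^sub>R f w)"
      by (simp add: set_lebesgue_integral_def lborel_distr_plus)
    also have "\<dots> = integral\<^sup>L lborel h" unfolding hq
      using m by (intro integral_distr) auto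
    finally show ?thesis ..
  qed
  have rot: "distr lborel borel (\<lambda>w::complex^'n. cis t *s w) = lborel" for t
    by (rule lborel_distr_linear_isometry)
       (auto simp: norm_vector_scalar_mult intro: bounded_linear.linear[OF bounded_linear_scalar_mult_right])
  have mrot[measurable]: "(\<lambda>w::complex^'n. cis t *s w) \<in> borel_measurable borel" for t
    by (intro borel_measurable_continuous_onI continuous_intros)
  have inth': "integrable lborel (\<lambda>w. h (cis t *s w))" for t
    using inth by (subst (asm) rot[of t, symmetric], subst (asm) integrable_distr_eq) auto
  have Irot: "(\<integral>w. h (cis t *s w) \<partial>lborel) = integral\<^sup>L lborel h" for t
    by (subst (2) rot[of t, symmetric], subst integral_distr) auto
  have Irot': "(\<integral>w. norm (h (cis t *s w)) \<partial>lborel) = (\<integral>w. norm (h w) \<partial>lborel)" for t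
    by (subst (2) rot[of t, symmetric], subst integral_distr) auto
  define k where "k = (\<lambda>(t, w). indicator {0..2*pi} t *\<^sub>R h (cis t *s w))"
  have "(\<lambda>p. cis (fst p) *s (snd p :: complex^'n)) \<in> borel_measurable borel"
    unfolding vector_scalar_mult_def by (intro borel_measurable_continuous_onI continuous_intros)
  then have [measurable]: "(\<lambda>p. h (cis (fst p) *s snd p)) \<in> borel_measurable (borel \<Otimes>\<^sub>M borel)"
    unfolding borel_prod by measurable
  have km: "k \<in> borel_measurable (lborel \<Otimes>\<^sub>M lborel)"
    unfolding k_def split_beta by measurable
  have kint: "integrable (lborel \<Otimes>\<^sub>M lborel) k"
  \<comment> \<open>Rotation invariance makes the inner integral of the norm independent of
    \<open>t\<close>, so the double integral over the bounded parameter interval converges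
    absolutely.\<close>
  proof (rule lborel_pair.Fubini_integrable[OF km])
    have "(\<lambda>t. \<integral>w. norm (k (t, w)) \<partial>lborel) = (\<lambda>t. indicator {0..2*pi} t *\<^sub>R (\<integral>w. norm (h w) \<partial>lborel))"
    proof
      fix t
      show "(\<integral>w. norm (k (t, w)) \<partial>lborel) = indicator {0..2*pi} t *\<^sub>R (\<integral>w. norm (h w) \<partial>lborel)"
        using Irot'[of t] by (cases "t \<in> {0..2*pi}") (auto simp: k_def)
    qed
    then show "integrable lborel (\<lambda>t. \<integral>w. norm (k (t, w)) \<partial>lborel)"
      by (auto intro!: integrable_scaleR_left integrable_real_indicator)
    show "AE t in lborel. integrable lborel (\<lambda>w. k (t, w))"
      using inth' by (auto simp: k_def)
  qed
  have sl: "(\<integral>t. k (t, w) \<partial>lborel) = (2 * pi) *\<^sub>R (indicator (ball 0 \<rho>) w *\<^sub>R f q)" for w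
  proof (cases "w \<in> ball 0 \<rho>")
    case True
    \<comment> \<open>For \<open>w\<close> in the open ball the whole closed disc of its slice is
      interior, so no regularity of \<open>f\<close> at the bounding sphere is required.\<close>
    have sub: "cball 0 1 \<subseteq> {\<zeta>. q + \<zeta> *s w \<in> ball q \<rho>}"
    proof
      fix \<zeta> :: complex assume "\<zeta> \<in> cball 0 1"
      then have "norm (\<zeta> *s w) \<le> 1 * norm w" unfolding norm_vector_scalar_mult by (intro mult_right_mono) auto
      then show "\<zeta> \<in> {\<zeta>. q + \<zeta> *s w \<in> ball q \<rho>}" using True by (simp add: add_in_ball_iff[simplified] dist_norm)
    qed
    have hol: "(\<lambda>\<zeta>. f (q + \<zeta> *s w)) holomorphic_on cball 0 1"
      by (rule holomorphic_on_subset[OF holomorphic_Cn_on_slice[OF f open_ball] sub])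
    then have c: "continuous_on (cball 0 1) (\<lambda>\<zeta>. f (q + \<zeta> *s w))" by (rule holomorphic_on_imp_continuous_on)
    have "((\<lambda>t. f (q + (0 + of_real 1 * cis t) *s w)) has_integral of_real (2 * pi) * f (q + 0 *s w)) {0..2*pi}"
      using hol by (intro has_integral_circle_mean_value[where f="\<lambda>\<zeta>. f (q + \<zeta> *s w)"] c)
        (auto intro: holomorphic_on_subset)
    then have I: "((\<lambda>t. f (q + cis t *s w)) has_integral of_real (2 * pi) * f q) {0..2*pi}" by simp
    have "continuous_on {0..2*pi} (\<lambda>t. f (q + cis t *s w))"
      by (rule continuous_on_compose2[OF c]) (auto intro!: continuous_intros)
    then have "set_integrable lborel {0..2*pi} (\<lambda>t. f (q + cis t *s w))" by (rule borel_integrable_atLeastAtMost')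
    then have "(LINT t:{0..2*pi}|lborel. f (q + cis t *s w)) = integral {0..2*pi} (\<lambda>t. f (q + cis t *s w))"
      by (rule set_borel_integral_eq_integral)
    also have "\<dots> = of_real (2 * pi) * f q" using I by (rule integral_unique)
    finally have "(\<integral>t. indicator {0..2*pi} t *\<^sub>R f (q + cis t *s w) \<partial>lborel) = of_real (2 * pi) * f q"
      by (simp add: set_lebesgue_integral_def)
    moreover have "k (t, w) = indicator {0..2*pi} t *\<^sub>R f (q + cis t *s w)" for t
      using True by (simp add: k_def h_def norm_vector_scalar_mult)
    ultimately show ?thesis using True by (simp add: scaleR_conv_of_real)
  next
    case False
    then have "k (t, w) = 0" for t by (simp add: k_def h_def norm_vector_scalar_mult)
    then show ?thesis using False by simp
  qed
  have "(2 * pi) *\<^sub>R integral\<^sup>L lborel h = (\<integral>t. indicator {0..2*pi} t *\<^sub>R integral\<^sup>L lborel h \<partial>lborel)"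
    by simp
  also have "\<dots> = (\<integral>t. (\<integral>w. k (t, w) \<partial>lborel) \<partial>lborel)"
    by (simp add: k_def Irot)
  also have "\<dots> = (\<integral>w. (\<integral>t. k (t, w) \<partial>lborel) \<partial>lborel)"
    using lborel_pair.Fubini_integral[of "\<lambda>t w. k (t, w)"] kint by simp
  also have "\<dots> = (2 * pi) *\<^sub>R (\<integral>w. indicator (ball (0::complex^'n) \<rho>) w *\<^sub>R f q \<partial>lborel)"
    unfolding sl by (rule Bochner_Integration.integral_scaleR_right)
  also have "(\<integral>w. indicator (ball (0::complex^'n) \<rho>) w *\<^sub>R f q \<partial>lborel) = measure lborel (ball (0::complex^'n) \<rho>) *\<^sub>R f q"
    by (subst integral_scaleR_left) auto
  also have "measure lborel (ball (0::complex^'n) \<rho>) = measure lborel (ball q \<rho>)"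
    by (cases "0 \<le> \<rho>") (auto simp: content_ball ball_empty)
  finally show ?thesis unfolding Ih by (simp del: scaleR_scaleR)
qed

section \<open>The Bergman kernel\<close>

lemma measure_ball_pos: "0 < r \<Longrightarrow> 0 < measure lborel (ball (c::'a::euclidean_space) r)"
  by (simp add: content_ball unit_ball_vol_pos)

lemma emeasure_lborel_open_pos:
  fixes U :: "'a::euclidean_space set"
  assumes "open U" "U \<noteq> {}"
  shows "0 < emeasure lborel U"
proof -
  obtain x e where "e > 0" "ball x e \<subseteq> U" using assms unfolding open_contains_ball by blast
  then have "0 < emeasure lborel (ball x e)" by (simp add: emeasure_ball unit_ball_vol_pos)
  also have "\<dots> \<le> emeasure lborel U" using \<open>ball x e \<subseteq> U\<close> assms by (intro emeasure_mono) auto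
  finally show ?thesis .
qed

text \<open>Connectedness is used twice: a ball leaving \<open>\<Omega>\<close> would meet the
  frontier closer than the distance allows, and \<open>\<Omega>\<close> leaving the ball must cross
  the sphere, which gives \<open>p\<close>. Boundedness makes the frontier nonempty, without which
  \<open>infdist\<close> would be 0 by convention.\<close>

lemma bdry_dist_domain:
  fixes \<Omega> :: "(complex^'n) set"
  assumes "domain_Cn \<Omega>" "bounded \<Omega>" "z \<in> \<Omega>"
  shows "0 < bdry_dist \<Omega> z" "ball z (bdry_dist \<Omega> z) \<subseteq> \<Omega>"
    "\<Omega> = ball z (bdry_dist \<Omega> z) \<or> (\<exists>p\<in>\<Omega>. norm (p - z) = bdry_dist \<Omega> z)"
proof -
  have \<Omega>: "open \<Omega>" "connected \<Omega>" "\<Omega> \<noteq> {}" using assms(1) by (auto simp: domain_Cn_def)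
  have ne: "frontier \<Omega> \<noteq> {}" using \<Omega> assms(2) frontier_eq_empty not_bounded_UNIV by metis
  have "z \<notin> frontier \<Omega>" using \<Omega> assms(3) by (simp add: frontier_def interior_open)
  then have "infdist z (frontier \<Omega>) \<noteq> 0"
    using in_closed_iff_infdist_zero[OF frontier_closed ne] by blast
  then show pos: "0 < bdry_dist \<Omega> z" unfolding bdry_dist_def using infdist_nonneg[of z "frontier \<Omega>"] by linarith
  show sub: "ball z (bdry_dist \<Omega> z) \<subseteq> \<Omega>"
  proof (rule ccontr)
    assume "\<not> ?thesis"
    moreover have "z \<in> ball z (bdry_dist \<Omega> z) \<inter> \<Omega>" using pos assms(3) by simp
    ultimately have "ball z (bdry_dist \<Omega> z) \<inter> frontier \<Omega> \<noteq> {}"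
      by (intro connected_Int_frontier connected_ball) blast+
    then obtain x where "x \<in> frontier \<Omega>" "dist z x < bdry_dist \<Omega> z" by auto
    with infdist_le[of x "frontier \<Omega>" z] show False by (simp add: bdry_dist_def)
  qed
  show "\<Omega> = ball z (bdry_dist \<Omega> z) \<or> (\<exists>p\<in>\<Omega>. norm (p - z) = bdry_dist \<Omega> z)"
  proof (cases "\<Omega> \<subseteq> ball z (bdry_dist \<Omega> z)")
    case False
    have "\<Omega> \<inter> frontier (ball z (bdry_dist \<Omega> z)) \<noteq> {}"
      using False \<Omega> assms(3) pos by (intro connected_Int_frontier) auto
    then show ?thesis using pos by (auto simp: dist_norm norm_minus_commute)
  qed (use sub in blast)
qed

lemma bdry_dist_ball:
  fixes z :: "complex^'n"
  assumes "0 < r"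
  shows "bdry_dist (ball z r) z = r"
proof -
  have ne: "sphere z r \<noteq> {}" using assms by simp
  have "dist z ` sphere z r = {r}" using ne by (auto simp: sphere_def)
  then show ?thesis using assms ne by (simp add: bdry_dist_def infdist_def)
qed

text \<open>Moves the norm from the completed measure to \<open>lborel\<close>, where Fubini and
  translation apply; continuity on the open set \<open>\<Omega>\<close> provides Borel
  representatives.\<close>

lemma bergman_space_borel:
  fixes f :: "complex^'n \<Rightarrow> complex"
  assumes "open \<Omega>" "f \<in> bergman_space \<Omega>"
  shows "(\<lambda>w. indicator \<Omega> w *\<^sub>R f w) \<in> borel_measurable borel"
    and "integrable lborel (\<lambda>w. indicator \<Omega> w *\<^sub>R (norm (f w))\<^sup>2)"
    and "(\<integral>w. indicator \<Omega> w *\<^sub>R (norm (f w))\<^sup>2 \<partial>lborel) = (L2_norm_on \<Omega> f)\<^sup>2"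
proof -
  have hol: "holomorphic_Cn_on f \<Omega>" and int: "set_integrable lebesgue \<Omega> (\<lambda>w. (norm (f w))\<^sup>2)"
    using assms(2) by (auto simp: bergman_space_def)
  have c: "continuous_on \<Omega> f" by (rule holomorphic_Cn_on_imp_continuous_on[OF hol])
  then show "(\<lambda>w. indicator \<Omega> w *\<^sub>R f w) \<in> borel_measurable borel"
    using assms(1) by (intro borel_measurable_continuous_on_indicator) auto
  have "(\<lambda>w. indicator \<Omega> w *\<^sub>R (norm (f w))\<^sup>2) \<in> borel_measurable borel"
    using assms(1)
    by (intro borel_measurable_continuous_on_indicator continuous_on_power continuous_on_norm c) simp
  then have m: "(\<lambda>w. indicator \<Omega> w *\<^sub>R (norm (f w))\<^sup>2) \<in> borel_measurable lborel" by simp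
  show "integrable lborel (\<lambda>w. indicator \<Omega> w *\<^sub>R (norm (f w))\<^sup>2)"
    using int integrable_completion[OF m] by (simp add: set_integrable_def)
  have "0 \<le> (LINT w:\<Omega>|lebesgue. (norm (f w))\<^sup>2)"
    unfolding set_lebesgue_integral_def by (intro integral_nonneg_AE) auto
  then have "(L2_norm_on \<Omega> f)\<^sup>2 = (LINT w:\<Omega>|lebesgue. (norm (f w))\<^sup>2)"
    unfolding L2_norm_on_def by simp
  also have "\<dots> = (\<integral>w. indicator \<Omega> w *\<^sub>R (norm (f w))\<^sup>2 \<partial>lborel)"
    unfolding set_lebesgue_integral_def by (rule integral_completion[OF m])
  finally show "(\<integral>w. indicator \<Omega> w *\<^sub>R (norm (f w))\<^sup>2 \<partial>lborel) = (L2_norm_on \<Omega> f)\<^sup>2" ..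
qed

lemma bergman_space_ball_mean:
  fixes f :: "complex^'n \<Rightarrow> complex"
  assumes "open \<Omega>" "f \<in> bergman_space \<Omega>" "ball q \<rho> \<subseteq> \<Omega>"
  shows "integrable lborel (\<lambda>w. indicator (ball q \<rho>) w *\<^sub>R f w)"
    and "(\<integral>w. indicator (ball q \<rho>) w *\<^sub>R f w \<partial>lborel) = measure lborel (ball q \<rho>) *\<^sub>R f q"
proof -
  note b = bergman_space_borel[OF assms(1,2)]
  \<comment> \<open>Square integrability yields integrability on the ball through |f| \<le> 1 +
    |f|^2.\<close>
  have "integrable lborel (\<lambda>w. indicator (ball q \<rho>) w + indicator \<Omega> w *\<^sub>R (norm (f w))\<^sup>2)"
    using b(2) by (intro Bochner_Integration.integrable_add integrable_real_indicator) (auto simp: emeasure_ball_less_top)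
  then show int: "integrable lborel (\<lambda>w. indicator (ball q \<rho>) w *\<^sub>R f w)"
  proof (rule Bochner_Integration.integrable_bound)
    have "(\<lambda>w. indicator (ball q \<rho>) w *\<^sub>R (indicator \<Omega> w *\<^sub>R f w)) \<in> borel_measurable borel"
      by (rule borel_measurable_scaleR[OF borel_measurable_indicator b(1)]) simp
    moreover have "(\<lambda>w. indicator (ball q \<rho>) w *\<^sub>R (indicator \<Omega> w *\<^sub>R f w)) = (\<lambda>w. indicator (ball q \<rho>) w *\<^sub>R f w)"
      using assms(3) by (auto simp: indicator_def fun_eq_iff)
    ultimately show "(\<lambda>w. indicator (ball q \<rho>) w *\<^sub>R f w) \<in> borel_measurable lborel" by simp
    have "x \<le> 1 + x\<^sup>2" for x :: real
      using zero_le_power2[of "x - 1/2"] by (simp add: power2_eq_square algebra_simps)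
    then show "AE w in lborel. norm (indicator (ball q \<rho>) w *\<^sub>R f w) \<le> norm (indicator (ball q \<rho>) w + indicator \<Omega> w *\<^sub>R (norm (f w))\<^sup>2)"
      using assms(3) by (intro AE_I2) (auto simp: indicator_def)
  qed
  have "holomorphic_Cn_on f (ball q \<rho>)"
    using assms(2,3) by (auto simp: bergman_space_def holomorphic_Cn_on_def)
  then show "(\<integral>w. indicator (ball q \<rho>) w *\<^sub>R f w \<partial>lborel) = measure lborel (ball q \<rho>) *\<^sub>R f q"
    using integral_ball_holomorphic[of f q \<rho>] int by (simp add: set_integrable_def set_lebesgue_integral_def)
qed

text \<open>If integration against \<open>\<phi>\<close> reproduces the value at \<open>z\<close> on the Bergman space, then the Cauchy--Schwarz
  inequality bounds the kernel by the squared norm of \<open>\<phi>\<close>.\<close>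

lemma bergman_kernel_le_reproducing:
  fixes z :: "complex^'n" and \<phi> :: "complex^'n \<Rightarrow> real"
  assumes "open \<Omega>" and [measurable]: "\<phi> \<in> borel_measurable borel"
    and sq: "integrable lborel (\<lambda>w. (\<phi> w)\<^sup>2)" and supp: "\<And>w. w \<notin> \<Omega> \<Longrightarrow> \<phi> w = 0"
    and int: "\<And>f. f \<in> bergman_space \<Omega> \<Longrightarrow> integrable lborel (\<lambda>w. \<phi> w *\<^sub>R f w)"
    and repr: "\<And>f. f \<in> bergman_space \<Omega> \<Longrightarrow> (\<integral>w. \<phi> w *\<^sub>R f w \<partial>lborel) = f z"
  shows "bergman_kernel \<Omega> z \<le> ennreal (\<integral>w. (\<phi> w)\<^sup>2 \<partial>lborel)"
  unfolding bergman_kernel_def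
proof (rule SUP_least)
  fix f assume "f \<in> {f \<in> bergman_space \<Omega>. L2_norm_on \<Omega> f \<le> 1}"
  then have f: "f \<in> bergman_space \<Omega>" "L2_norm_on \<Omega> f \<le> 1" by auto
  note b = bergman_space_borel[OF assms(1) f(1)]
  have [measurable]: "(\<lambda>w. indicator \<Omega> w *\<^sub>R f w) \<in> borel_measurable borel" by (rule b(1))
  have "ennreal (norm (f z)) \<le> (\<integral>\<^sup>+w. ennreal (norm (\<phi> w *\<^sub>R f w)) \<partial>lborel)"
    using integral_norm_bound_ennreal[OF int[OF f(1)]] repr[OF f(1)] by simp
  also have "\<dots> = (\<integral>\<^sup>+w. ennreal \<bar>\<phi> w\<bar> * ennreal (norm (indicator \<Omega> w *\<^sub>R f w)) \<partial>lborel)"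
  proof (rule nn_integral_cong)
    fix w show "ennreal (norm (\<phi> w *\<^sub>R f w)) = ennreal \<bar>\<phi> w\<bar> * ennreal (norm (indicator \<Omega> w *\<^sub>R f w))"
      using supp[of w] by (cases "w \<in> \<Omega>") (auto simp: ennreal_mult)
  qed
  finally have "(ennreal (norm (f z)))\<^sup>2 \<le> (\<integral>\<^sup>+w. ennreal \<bar>\<phi> w\<bar> * ennreal (norm (indicator \<Omega> w *\<^sub>R f w)) \<partial>lborel)\<^sup>2"
    by (intro power_mono) auto
  also have "\<dots> \<le> (\<integral>\<^sup>+w. (ennreal \<bar>\<phi> w\<bar>)\<^sup>2 \<partial>lborel) * (\<integral>\<^sup>+w. (ennreal (norm (indicator \<Omega> w *\<^sub>R f w)))\<^sup>2 \<partial>lborel)"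
    by (rule Cauchy_Schwarz_nn_integral) measurable
  also have "(\<integral>\<^sup>+w. (ennreal \<bar>\<phi> w\<bar>)\<^sup>2 \<partial>lborel) = ennreal (\<integral>w. (\<phi> w)\<^sup>2 \<partial>lborel)"
    using nn_integral_eq_integral[OF sq] by (simp add: ennreal_power)
  also have "(\<integral>\<^sup>+w. (ennreal (norm (indicator \<Omega> w *\<^sub>R f w)))\<^sup>2 \<partial>lborel) = (\<integral>\<^sup>+w. ennreal (indicator \<Omega> w *\<^sub>R (norm (f w))\<^sup>2) \<partial>lborel)"
    by (intro nn_integral_cong) (auto simp: ennreal_power indicator_def)
  also have "\<dots> = ennreal ((L2_norm_on \<Omega> f)\<^sup>2)"
    using nn_integral_eq_integral[OF b(2)] b(3) by simp
  also have "\<dots> \<le> 1"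
    using f(2) L2_norm_on_def[of \<Omega> f] by (simp add: power_le_one set_lebesgue_integral_def integral_nonneg_AE)
  finally have "(ennreal (norm (f z)))\<^sup>2 \<le> ennreal (\<integral>w. (\<phi> w)\<^sup>2 \<partial>lborel) * 1"
    by (simp add: mult_left_mono)
  then show "ennreal ((norm (f z))\<^sup>2) \<le> ennreal (\<integral>w. (\<phi> w)\<^sup>2 \<partial>lborel)" by (simp add: ennreal_power)
qed

lemma bergman_kernel_le_ball:
  fixes z :: "complex^'n"
  assumes "open \<Omega>" "ball z \<delta> \<subseteq> \<Omega>" "0 < \<delta>"
  shows "bergman_kernel \<Omega> z \<le> ennreal (1 / measure lborel (ball z \<delta>))"
proof -
  define V where "V = measure lborel (ball z \<delta>)"
  have V: "0 < V" unfolding V_def by (rule measure_ball_pos[OF assms(3)])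
  define \<phi> where "\<phi> w = indicator (ball z \<delta>) w / V" for w
  have sq: "(\<lambda>w. (\<phi> w)\<^sup>2) = (\<lambda>w. indicator (ball z \<delta>) w * (1 / V\<^sup>2))"
    by (auto simp: \<phi>_def indicator_def fun_eq_iff power_divide)
  have sc: "\<phi> w *\<^sub>R f w = (1 / V) *\<^sub>R (indicator (ball z \<delta>) w *\<^sub>R f w)" for w and f :: "complex^'n \<Rightarrow> complex"
    by (simp add: \<phi>_def)
  have "bergman_kernel \<Omega> z \<le> ennreal (\<integral>w. (\<phi> w)\<^sup>2 \<partial>lborel)"
  proof (rule bergman_kernel_le_reproducing[OF assms(1)])
    show "\<phi> \<in> borel_measurable borel" unfolding \<phi>_def by (intro borel_measurable_divide borel_measurable_indicator borel_measurable_const) simp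
    show "integrable lborel (\<lambda>w. (\<phi> w)\<^sup>2)" unfolding sq by (intro integrable_mult_left) simp
    show "\<phi> w = 0" if "w \<notin> \<Omega>" for w using that assms(2) by (auto simp: \<phi>_def indicator_def)
    fix f assume f: "f \<in> bergman_space \<Omega>"
    note m = bergman_space_ball_mean[OF assms(1) f assms(2)]
    show "integrable lborel (\<lambda>w. \<phi> w *\<^sub>R f w)" unfolding sc by (intro integrable_scaleR_right m)
    show "(\<integral>w. \<phi> w *\<^sub>R f w \<partial>lborel) = f z"
      unfolding sc Bochner_Integration.integral_scaleR_right m using V by (simp add: V_def)
  qed
  also have "(\<integral>w. (\<phi> w)\<^sup>2 \<partial>lborel) = 1 / V" unfolding sq using V by (simp add: V_def power2_eq_square)
  finally show ?thesis by (simp add: V_def)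
qed

text \<open>If \<open>\<Omega>\<close> contains a ball \<open>B2\<close> sticking out of \<open>B0 = ball z \<delta>\<close> and a concentric ball \<open>B1\<close> inside \<open>B0\<close>, then the
  difference \<open>\<psi>\<close> of the means over \<open>B1\<close> and \<open>B2\<close> annihilates the Bergman space but is not orthogonal to the
  mean over \<open>B0\<close>; subtracting a small multiple of \<open>\<psi>\<close> shortens the reproducing functional.\<close>

lemma bergman_kernel_less_ball:
  fixes z :: "complex^'n"
  assumes "open \<Omega>" "ball z \<delta> \<subseteq> \<Omega>" "0 < \<delta>" "ball q \<rho>1 \<subseteq> ball z \<delta>" "ball q \<rho>2 \<subseteq> \<Omega>" "0 < \<rho>1" "0 < \<rho>2"
    and out: "\<not> ball q \<rho>2 \<subseteq> cball z \<delta>"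
  shows "bergman_kernel \<Omega> z < ennreal (1 / measure lborel (ball z \<delta>))"
proof -
  define B0 B1 B2 where B: "B0 = ball z \<delta>" "B1 = ball q \<rho>1" "B2 = ball q \<rho>2"
  define V where "V X = measure lborel X" for X :: "(complex^'n) set"
  have V: "0 < V B0" "0 < V B1" "0 < V B2" unfolding V_def B by (intro measure_ball_pos assms)+
  have fin: "B0 \<in> fmeasurable lborel" "B1 \<in> fmeasurable lborel" "B2 \<in> fmeasurable lborel"
    by (simp_all add: B fmeasurable_def emeasure_ball_less_top)
  have V02: "V (B0 \<inter> B2) < V B2"
  proof -
    \<comment> \<open>The part of \<open>B2\<close> outside the closed ball is open and nonempty,
      hence of positive volume. This strict loss is what makes \<open>\<kappa>\<close>
      positive.\<close>
    have "0 < emeasure lborel (ball q \<rho>2 - cball z \<delta>)"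
      using out by (intro emeasure_lborel_open_pos open_Diff) auto
    also have "\<dots> \<le> emeasure lborel (B2 - B0)" unfolding B by (intro emeasure_mono) auto
    also have "\<dots> = ennreal (V (B2 - B0))" unfolding V_def by (intro emeasure_eq_measure2 fmeasurable_Diff fmeasurableD fin)
    finally have "0 < V (B2 - B0)" by simp
    moreover have "V B2 = V (B2 - B0) + V (B0 \<inter> B2)"
    proof -
      have "(B2 - B0) \<union> (B0 \<inter> B2) = B2" by blast
      moreover have "measure lborel ((B2 - B0) \<union> (B0 \<inter> B2)) = measure lborel (B2 - B0) + measure lborel (B0 \<inter> B2)"
        by (intro measure_Un_AE AE_I2 fmeasurable_Diff fmeasurable_Int_fmeasurable fmeasurableD fin) auto
      ultimately show ?thesis by (simp add: V_def)
    qed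
    ultimately show ?thesis by simp
  qed
  define \<phi> where "\<phi> w = indicator B0 w / V B0" for w
  define \<psi> where "\<psi> w = indicator B1 w / V B1 - indicator B2 w / V B2" for w
  have ii: "integrable lborel (\<lambda>w. indicator X w * indicator Y w :: real)"
    if "X \<in> fmeasurable lborel" "Y \<in> fmeasurable lborel" for X Y
  proof -
    have "X \<inter> Y \<in> fmeasurable lborel" using that by (intro fmeasurable_Int_fmeasurable) auto
    then show ?thesis unfolding indicator_inter_arith[symmetric]
      by (intro integrable_real_indicator) (auto simp: fmeasurable_def)
  qed
  have \<phi>2: "(\<lambda>w. (\<phi> w)\<^sup>2) = (\<lambda>w. indicator B0 w * indicator B0 w * (1 / (V B0)\<^sup>2))"
    by (auto simp: \<phi>_def power_divide power2_eq_square)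
  have \<phi>\<psi>: "(\<lambda>w. \<phi> w * \<psi> w) = (\<lambda>w. indicator B0 w * indicator B1 w * (1 / (V B0 * V B1)) - indicator B0 w * indicator B2 w * (1 / (V B0 * V B2)))"
    using V by (auto simp: \<phi>_def \<psi>_def field_simps)
  have \<psi>2: "(\<lambda>w. (\<psi> w)\<^sup>2) = (\<lambda>w. indicator B1 w * indicator B1 w * (1 / (V B1)\<^sup>2) - indicator B1 w * indicator B2 w * (2 / (V B1 * V B2))
      + indicator B2 w * indicator B2 w * (1 / (V B2)\<^sup>2))"
    using V by (auto simp: \<psi>_def field_simps power2_eq_square)
  have int: "integrable lborel (\<lambda>w. (\<phi> w)\<^sup>2)" "integrable lborel (\<lambda>w. \<phi> w * \<psi> w)" "integrable lborel (\<lambda>w. (\<psi> w)\<^sup>2)"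
    unfolding \<phi>2 \<phi>\<psi> \<psi>2
    by (intro Bochner_Integration.integrable_diff Bochner_Integration.integrable_add integrable_mult_left ii fin)+
  define D where "D = (\<integral>w. (\<psi> w)\<^sup>2 \<partial>lborel)"
  have D: "0 \<le> D" unfolding D_def by (intro integral_nonneg_AE) auto
  define \<kappa> where "\<kappa> = (\<integral>w. \<phi> w * \<psi> w \<partial>lborel)"
  have "\<kappa> = V (B0 \<inter> B1) / (V B0 * V B1) - V (B0 \<inter> B2) / (V B0 * V B2)"
    unfolding \<kappa>_def \<phi>\<psi>
    by (subst Bochner_Integration.integral_diff)
      (auto simp: indicator_inter_arith[symmetric] V_def intro!: integrable_mult_left ii[unfolded indicator_inter_arith[symmetric]] fin)
  also have "B0 \<inter> B1 = B1" using assms(4) by (auto simp: B)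
  also have "V B1 / (V B0 * V B1) - V (B0 \<inter> B2) / (V B0 * V B2) = (V B2 - V (B0 \<inter> B2)) / (V B0 * V B2)"
    using V by (simp add: field_simps)
  also have "\<dots> > 0" using V V02 by simp
  finally have \<kappa>: "0 < \<kappa>" .
  \<comment> \<open>The squared norm is a quadratic in \<open>t\<close> with slope
    \<open>2 * \<kappa>\<close> at 0 and leading coefficient \<open>D\<close>. The denominator
    \<open>D + 1\<close> in place of \<open>D\<close> avoids treating \<open>D = 0\<close> apart and
    still gives a negative increment.\<close>
  define t where "t = - \<kappa> / (D + 1)"
  define \<eta> where "\<eta> w = \<phi> w + t * \<psi> w" for w
  have \<eta>2: "(\<lambda>w. (\<eta> w)\<^sup>2) = (\<lambda>w. (\<phi> w)\<^sup>2 + (2 * t) * (\<phi> w * \<psi> w) + t\<^sup>2 * (\<psi> w)\<^sup>2)"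
    by (simp add: \<eta>_def power2_eq_square algebra_simps)
  have sc: "\<eta> w *\<^sub>R f w = (1 / V B0) *\<^sub>R (indicator B0 w *\<^sub>R f w) + ((t / V B1) *\<^sub>R (indicator B1 w *\<^sub>R f w)
      - (t / V B2) *\<^sub>R (indicator B2 w *\<^sub>R f w))" for w and f :: "complex^'n \<Rightarrow> complex"
    by (simp add: \<eta>_def \<phi>_def \<psi>_def algebra_simps)
  have sub: "B0 \<subseteq> \<Omega>" "B1 \<subseteq> \<Omega>" "B2 \<subseteq> \<Omega>" using assms by (auto simp: B)
  have "bergman_kernel \<Omega> z \<le> ennreal (\<integral>w. (\<eta> w)\<^sup>2 \<partial>lborel)"
  proof (rule bergman_kernel_le_reproducing[OF assms(1)])
    show "\<eta> \<in> borel_measurable borel" unfolding \<eta>_def \<phi>_def \<psi>_def B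
      by (intro borel_measurable_add borel_measurable_times borel_measurable_diff borel_measurable_divide
          borel_measurable_indicator borel_measurable_const) simp_all
    show "integrable lborel (\<lambda>w. (\<eta> w)\<^sup>2)" unfolding \<eta>2
      by (intro Bochner_Integration.integrable_add integrable_mult_right int)
    show "\<eta> w = 0" if "w \<notin> \<Omega>" for w
    proof -
      have "w \<notin> B0" "w \<notin> B1" "w \<notin> B2" using that sub by auto
      then show ?thesis by (simp add: \<eta>_def \<phi>_def \<psi>_def)
    qed
    fix f assume f: "f \<in> bergman_space \<Omega>"
    note m0 = bergman_space_ball_mean[OF assms(1) f sub(1)[unfolded B], folded B]
    note m1 = bergman_space_ball_mean[OF assms(1) f sub(2)[unfolded B], folded B]
    note m2 = bergman_space_ball_mean[OF assms(1) f sub(3)[unfolded B], folded B]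
    note i = integrable_scaleR_right[OF m0(1)] integrable_scaleR_right[OF m1(1)] integrable_scaleR_right[OF m2(1)]
    show "integrable lborel (\<lambda>w. \<eta> w *\<^sub>R f w)" unfolding sc
      by (intro Bochner_Integration.integrable_add Bochner_Integration.integrable_diff i)
    have "(\<integral>w. \<eta> w *\<^sub>R f w \<partial>lborel) = (1 / V B0) *\<^sub>R (V B0 *\<^sub>R f z) + ((t / V B1) *\<^sub>R (V B1 *\<^sub>R f q) - (t / V B2) *\<^sub>R (V B2 *\<^sub>R f q))"
      unfolding sc using i
      by (simp only: Bochner_Integration.integral_add Bochner_Integration.integral_diff Bochner_Integration.integrable_diff
          Bochner_Integration.integral_scaleR_right m0(2) m1(2) m2(2) V_def)
    then show "(\<integral>w. \<eta> w *\<^sub>R f w \<partial>lborel) = f z" using V by simp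
  qed
  also have "(\<integral>w. (\<eta> w)\<^sup>2 \<partial>lborel) = (\<integral>w. (\<phi> w)\<^sup>2 \<partial>lborel) + 2 * t * \<kappa> + t\<^sup>2 * D"
    unfolding \<eta>2 \<kappa>_def D_def using int by simp
  also have "(\<integral>w. (\<phi> w)\<^sup>2 \<partial>lborel) = 1 / V B0"
    unfolding \<phi>2 indicator_inter_arith[symmetric] using V by (simp add: V_def power2_eq_square)
  also have "ennreal (1 / V B0 + 2 * t * \<kappa> + t\<^sup>2 * D) < ennreal (1 / V B0)"
  proof (rule ennreal_lessI)
    have "t * D + \<kappa> = \<kappa> / (D + 1)" using D by (simp add: t_def field_simps)
    moreover have "2 * t * \<kappa> + t\<^sup>2 * D = t * \<kappa> + t * (t * D + \<kappa>)" by (simp add: power2_eq_square algebra_simps)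
    moreover have "t < 0" using D \<kappa> by (simp add: t_def divide_neg_pos)
    moreover have "0 < \<kappa> / (D + 1)" using D \<kappa> by simp
    ultimately have "2 * t * \<kappa> + t\<^sup>2 * D < 0" using \<kappa> by (metis add_neg_neg mult_neg_pos)
    then show "1 / V B0 + 2 * t * \<kappa> + t\<^sup>2 * D < 1 / V B0" by simp
  qed (use V in simp)
  finally show ?thesis by (simp add: V_def B)
qed

section \<open>The two inequalities and their equality cases\<close>

lemma emeasure_ball_Cn:
  fixes c :: "complex^'n"
  assumes "0 \<le> r"
  shows "emeasure lborel (ball c r) = ennreal (pi ^ CARD('n) / fact CARD('n) * r ^ (2 * CARD('n)))"
  using emeasure_ball[OF assms, of c] unit_ball_vol_even[of "CARD('n)"] by (simp add: mult.commute)

lemma azukawa_indicatrix_volume: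
  fixes \<Omega> :: "(complex^'n) set"
  assumes \<Omega>: "domain_Cn \<Omega>" "bounded \<Omega>" and z: "z \<in> \<Omega>"
  defines "\<delta> \<equiv> bdry_dist \<Omega> z"
  shows "emeasure lborel (ball z \<delta>) \<le> emeasure lebesgue (azukawa_indicatrix \<Omega> z)"
    and "emeasure lebesgue (azukawa_indicatrix \<Omega> z) = emeasure lborel (ball z \<delta>) \<longleftrightarrow> (\<exists>r>0. \<Omega> = ball z r)"
proof -
  note bd = bdry_dist_domain[OF \<Omega> z, folded \<delta>_def]
  have op: "open \<Omega>" using \<Omega> by (simp add: domain_Cn_def)
  have I: "azukawa_indicatrix \<Omega> z \<in> sets borel" by (rule sets_borel_azukawa_indicatrix[OF op z])
  then have eI: "emeasure lebesgue (azukawa_indicatrix \<Omega> z) = emeasure lborel (azukawa_indicatrix \<Omega> z)" by simp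
  have b0: "emeasure lborel (ball (0::complex^'n) \<delta> - {0}) = emeasure lborel (ball z \<delta>)"
    using bd(1) by (subst emeasure_Diff_null_set) (auto simp: emeasure_ball)
  have sub: "ball 0 \<delta> - {0} \<subseteq> azukawa_indicatrix \<Omega> z"
    by (rule ball_subset_azukawa_indicatrix[OF bd(2,1)])
  then show le: "emeasure lborel (ball z \<delta>) \<le> emeasure lebesgue (azukawa_indicatrix \<Omega> z)"
    unfolding eI b0[symmetric] using I by (intro emeasure_mono) auto
  show "emeasure lebesgue (azukawa_indicatrix \<Omega> z) = emeasure lborel (ball z \<delta>) \<longleftrightarrow> (\<exists>r>0. \<Omega> = ball z r)"
  proof
    assume eq: "emeasure lebesgue (azukawa_indicatrix \<Omega> z) = emeasure lborel (ball z \<delta>)"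
    have "\<not> (\<exists>p\<in>\<Omega>. norm (p - z) = \<delta>)"
    proof
      assume "\<exists>p\<in>\<Omega>. norm (p - z) = \<delta>"
      then obtain p where p: "p \<in> \<Omega>" "norm (p - z) = \<delta>" by blast
      obtain W where W: "open W" "W \<noteq> {}" "W \<subseteq> azukawa_indicatrix \<Omega> z" "W \<inter> ball 0 \<delta> = {}"
        using azukawa_indicatrix_bulge[OF op bd(2,1) p] .
      \<comment> \<open>Finite volume of the ball makes the addition of the positive volume of
        \<open>W\<close> strict in \<open>ennreal\<close>.\<close>
      have "emeasure lborel (ball z \<delta>) + 0 < emeasure lborel (ball z \<delta>) + emeasure lborel W"
        using emeasure_lborel_open_pos[OF W(1,2)] emeasure_ball_less_top[of z \<delta>] by (subst ennreal_add_left_cancel_less) auto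
      also have "\<dots> = emeasure lborel ((ball 0 \<delta> - {0}) \<union> W)"
        unfolding b0[symmetric] using W by (intro plus_emeasure) auto
      also have "\<dots> \<le> emeasure lborel (azukawa_indicatrix \<Omega> z)"
        using W sub I by (intro emeasure_mono) auto
      finally show False using eq eI by simp
    qed
    with bd show "\<exists>r>0. \<Omega> = ball z r" by blast
  next
    assume "\<exists>r>0. \<Omega> = ball z r"
    then obtain r where r: "r > 0" "\<Omega> = ball z r" by blast
    then have "\<delta> = r" by (simp add: \<delta>_def bdry_dist_ball)
    have "emeasure lborel (azukawa_indicatrix \<Omega> z) \<le> emeasure lborel (ball (0::complex^'n) r)"
      unfolding r(2) by (intro emeasure_mono azukawa_indicatrix_ball_subset r) simp
    also have "\<dots> = emeasure lborel (ball z \<delta>)" using r \<open>\<delta> = r\<close> by (simp add: emeasure_ball)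
    finally show "emeasure lebesgue (azukawa_indicatrix \<Omega> z) = emeasure lborel (ball z \<delta>)"
      using le unfolding eI by (rule antisym)
  qed
qed

text \<open>The constant function of norm 1 already attains the upper bound.\<close>

lemma bergman_kernel_ball_ge:
  fixes z :: "complex^'n"
  assumes "0 < r"
  shows "ennreal (1 / measure lborel (ball z r)) \<le> bergman_kernel (ball z r) z"
proof -
  define V where "V = measure lborel (ball z r)"
  have V: "0 < V" unfolding V_def by (rule measure_ball_pos[OF assms])
  define f where "f w = complex_of_real (1 / sqrt V)" for w :: "complex^'n"
  have nf: "(norm (f w))\<^sup>2 = 1 / V" for w using V by (simp add: f_def norm_divide power_divide)
  have "((\<lambda>w. f w) has_derivative (\<lambda>_. 0)) (at w)" for w unfolding f_def by (rule has_derivative_const)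
  then have "holomorphic_Cn_on f (ball z r)"
    unfolding holomorphic_Cn_on_def by (intro ballI exI[of _ "\<lambda>_. 0"]) auto
  moreover have "set_integrable lebesgue (ball z r) (\<lambda>w. (norm (f w))\<^sup>2)"
    unfolding nf set_integrable_def using emeasure_ball_less_top[of z r]
    by (intro integrable_scaleR_left integrable_real_indicator) auto
  moreover have "(LINT w:ball z r|lebesgue. (norm (f w))\<^sup>2) = 1"
    unfolding nf set_lebesgue_integral_def using V emeasure_ball_less_top[of z r]
    by (subst integral_scaleR_left) (auto simp: V_def measure_completion intro!: integrable_real_indicator)
  ultimately have "f \<in> {f \<in> bergman_space (ball z r). L2_norm_on (ball z r) f \<le> 1}"
    by (simp add: bergman_space_def L2_norm_on_def)
  then have "ennreal ((norm (f z))\<^sup>2) \<le> bergman_kernel (ball z r) z"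
    unfolding bergman_kernel_def by (rule SUP_upper)
  then show ?thesis unfolding nf by (simp add: V_def)
qed

lemma bergman_kernel_bound:
  fixes \<Omega> :: "(complex^'n) set"
  assumes \<Omega>: "domain_Cn \<Omega>" "bounded \<Omega>" and z: "z \<in> \<Omega>"
  defines "\<delta> \<equiv> bdry_dist \<Omega> z"
  shows "bergman_kernel \<Omega> z \<le> ennreal (1 / measure lborel (ball z \<delta>))"
    and "bergman_kernel \<Omega> z = ennreal (1 / measure lborel (ball z \<delta>)) \<longleftrightarrow> (\<exists>r>0. \<Omega> = ball z r)"
proof -
  note bd = bdry_dist_domain[OF \<Omega> z, folded \<delta>_def]
  have op: "open \<Omega>" using \<Omega> by (simp add: domain_Cn_def)
  show le: "bergman_kernel \<Omega> z \<le> ennreal (1 / measure lborel (ball z \<delta>))"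
    by (rule bergman_kernel_le_ball[OF op bd(2,1)])
  show "bergman_kernel \<Omega> z = ennreal (1 / measure lborel (ball z \<delta>)) \<longleftrightarrow> (\<exists>r>0. \<Omega> = ball z r)"
  proof
    assume eq: "bergman_kernel \<Omega> z = ennreal (1 / measure lborel (ball z \<delta>))"
    have "\<not> (\<exists>p\<in>\<Omega>. norm (p - z) = \<delta>)"
    proof
      assume "\<exists>p\<in>\<Omega>. norm (p - z) = \<delta>"
      then obtain p where p: "p \<in> \<Omega>" "norm (p - z) = \<delta>" by blast
      obtain e0 where e0: "e0 > 0" "ball p e0 \<subseteq> \<Omega>" using op p by (auto simp: open_contains_ball)
      \<comment> \<open>The minimum with \<delta> keeps \<open>\<delta> - e / 4\<close> positive, so
        \<open>q\<close> lies between \<open>z\<close> and \<open>p\<close>.\<close>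
      define e where "e = min e0 \<delta>"
      have e: "0 < e" "e \<le> \<delta>" "ball p e \<subseteq> \<Omega>" using e0 bd(1) by (auto simp: e_def)
      define v where "v = (1 / \<delta>) *\<^sub>R (p - z)"
      have v: "norm v = 1" "p = z + \<delta> *\<^sub>R v" using p(2) bd(1) by (auto simp: v_def)
      \<comment> \<open>With the centre \<open>e / 4\<close> below the sphere, the ball of radius
        \<open>e / 4\<close> touches the sphere from inside and the ball of radius
        \<open>e / 2\<close> crosses it, within \<open>ball p e\<close>. The point at height
        \<open>e / 8\<close> above the sphere, at distance \<open>3 * e / 8\<close> from
        \<open>q\<close>, witnesses the crossing.\<close>
      define q where "q = z + (\<delta> - e / 4) *\<^sub>R v"
      have qz: "norm (q - z) = \<delta> - e / 4" using v(1) e by (simp add: q_def)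
      have "q - p = (- (e / 4)) *\<^sub>R v" by (simp add: q_def v(2) algebra_simps)
      then have qp: "norm (q - p) = e / 4" using v(1) e by simp
      have "bergman_kernel \<Omega> z < ennreal (1 / measure lborel (ball z \<delta>))"
      proof (rule bergman_kernel_less_ball[OF op bd(2,1)])
        show "ball q (e / 4) \<subseteq> ball z \<delta>"
          using qz norm_triangle_ineq[of "q - z"] by (subst ball_subset_ball_iff) (auto simp: dist_norm)
        have "ball q (e / 2) \<subseteq> ball p e"
          using qp e(1) by (subst ball_subset_ball_iff) (auto simp: dist_norm)
        then show "ball q (e / 2) \<subseteq> \<Omega>" using e(3) by blast
        define y where "y = z + (\<delta> + e / 8) *\<^sub>R v"
        have "y - q = ((\<delta> + e / 8) - (\<delta> - e / 4)) *\<^sub>R v"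
          unfolding y_def q_def scaleR_left_diff_distrib by simp
        then have "norm (y - q) = 3 * e / 8" using v(1) e by simp
        moreover have "norm (y - z) = \<delta> + e / 8" using v(1) e by (simp add: y_def)
        ultimately have "y \<in> ball q (e / 2)" "y \<notin> cball z \<delta>"
          using e by (auto simp: dist_norm norm_minus_commute)
        then show "\<not> ball q (e / 2) \<subseteq> cball z \<delta>" by blast
      qed (use e in auto)
      then show False using eq by simp
    qed
    with bd show "\<exists>r>0. \<Omega> = ball z r" by blast
  next
    assume "\<exists>r>0. \<Omega> = ball z r"
    then obtain r where r: "r > 0" "\<Omega> = ball z r" by blast
    then have "\<delta> = r" by (simp add: \<delta>_def bdry_dist_ball)
    then show "bergman_kernel \<Omega> z = ennreal (1 / measure lborel (ball z \<delta>))"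
      using le bergman_kernel_ball_ge[OF r(1), of z] r(2) by (intro antisym) auto
  qed
qed

theorem theorem1p6:
  fixes \<Omega> :: "(complex^'n) set"
  assumes "domain_Cn \<Omega>" and "bounded \<Omega>"
  shows "(\<forall>z\<in>\<Omega>. emeasure lebesgue (azukawa_indicatrix \<Omega> z)
            \<ge> ennreal (pi ^ CARD('n) / fact CARD('n) * bdry_dist \<Omega> z ^ (2 * CARD('n)))) \<and>
         (\<forall>z\<in>\<Omega>. bergman_kernel \<Omega> z
            \<le> ennreal (fact CARD('n) / (pi ^ CARD('n) * bdry_dist \<Omega> z ^ (2 * CARD('n))))) \<and>
         (\<forall>z0\<in>\<Omega>. emeasure lebesgue (azukawa_indicatrix \<Omega> z0)
            = ennreal (pi ^ CARD('n) / fact CARD('n) * bdry_dist \<Omega> z0 ^ (2 * CARD('n)))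
            \<longleftrightarrow> (\<exists>r>0. \<Omega> = ball z0 r)) \<and>
         (\<forall>z0\<in>\<Omega>. bergman_kernel \<Omega> z0
            = ennreal (fact CARD('n) / (pi ^ CARD('n) * bdry_dist \<Omega> z0 ^ (2 * CARD('n))))
            \<longleftrightarrow> (\<exists>r>0. \<Omega> = ball z0 r))"
proof -
  have e: "emeasure lborel (ball z (bdry_dist \<Omega> z)) =
      ennreal (pi ^ CARD('n) / fact CARD('n) * bdry_dist \<Omega> z ^ (2 * CARD('n)))" if "z \<in> \<Omega>" for z
    using bdry_dist_domain(1)[OF assms that] by (intro emeasure_ball_Cn) simp
  have m: "1 / measure lborel (ball z (bdry_dist \<Omega> z)) =
      fact CARD('n) / (pi ^ CARD('n) * bdry_dist \<Omega> z ^ (2 * CARD('n)))" if "z \<in> \<Omega>" for z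
    using e[OF that] bdry_dist_domain(1)[OF assms that] by (simp add: measure_def)
  show ?thesis
    using azukawa_indicatrix_volume[OF assms] bergman_kernel_bound[OF assms]
    by (intro conjI ballI) (simp_all only: e[symmetric] m[symmetric])
qed

end
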